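(* Let $R$ be a Noetherian commutative ring with $1\neq 0$, let $\alpha\in\{\text{atomic},\ \text{strongly atomic},\ \text{m-atomic},\ \text{very strongly atomic}\}$ and $\beta\in\{\text{associate},\ \text{strong associate},\ \text{very strong associate}\}$. Then the following conditions are equivalent. (1) $R$ is a $\beta$-FFR. (2) $R$ is a BFR and a $\beta$-WFFR. (3) $R$ is présimplifiable and a $\beta$-WFFR. (4) $\bigcap_{n=1}^\infty (y^n)=0$ for each non-unit $y\in R$ and $R$ is a $\beta$-WFFR. (5) $\bigcap_{n=1}^\infty I^n=0$ for each proper ideal $I$ of $R$ and $R$ is a $\beta$-WFFR. (6) $R$ is a BFR and an $\alpha$-$\beta$-divisor finite ring. (7) $R$ is présimplifiable and an $\alpha$-$\beta$-divisor finite ring. (8) $\bigcap_{n=1}^\infty (y^n)=0$ for each non-unit $y\in R$ and $R$ is an $\alpha$-$\beta$-divisor finite ring. (9) $\bigcap_{n=1}^\infty I^n=0$ for each proper ideal $I$ of $R$ and $R$ is an $\alpha$-$\beta$-divisor finite ring. (10) For all non-units $x\in R$, $\sum_{a\in V(G_\emptyset^\beta(x))}\mathrm{degl}(a)<\infty$. (11) For all non-units $x\in R$, $|E(G_\emptyset^\beta(x))|<\infty$. (12) $R$ is a BFR and for all $x\in R$ not a unit, $|V(G_\emptyset^\beta(x))|<\infty$. (13) $R$ is présimplifiable and for all $x\in R$ not a unit, $|V(G_\emptyset^\beta(x))|<\infty$. (14) $\bigcap_{n=1}^\infty (y^n)=0$ for each non-unit $y\in R$ and for all $x\in R$ not a unit,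 $|V(G_\emptyset^\beta(x))|<\infty$. (15) $\bigcap_{n=1}^\infty I^n=0$ for each proper ideal $I$ of $R$ and for all $x\in R$ not a unit, $|V(G_\emptyset^\beta(x))|<\infty$. (16) $R$ is a BFR and for all $x\in R$ not a unit, $|V(G_\alpha^\beta(x))|<\infty$. (17) $R$ is présimplifiable and for all $x\in R$ not a unit, $|V(G_\alpha^\beta(x))|<\infty$. (18) $\bigcap_{n=1}^\infty (y^n)=0$ for each non-unit $y\in R$ and for all $x\in R$ not a unit, $|V(G_\alpha^\beta(x))|<\infty$. (19) $\bigcap_{n=1}^\infty I^n=0$ for each proper ideal $I$ of $R$ and for all non-units $x\in R$, $|V(G_\alpha^\beta(x))|<\infty$.
   Context: $U(R)$ is the group of units of $R$. $R$ is présimplifiable if $x=xy$ implies $x=0$ or $y\in U(R)$. For $a,b\in R$: $a,b$ are associates, $a\sim b$, if $(a)=(b)$; strong associates, $a\approx b$, if $a=\lambda b$ for some $\lambda\in U(R)$; very strong associates, $a\cong b$, if $a\sim b$ and either $a=b=0$ or ($a=rb$ with $r\in R$ implies $r\in U(R)$). A non-unit $a\in R$ is: irreducible (atomic) if $a=bc$ implies $a\sim b$ or $a\sim c$; strongly irreducible (strongly atomic) if $a=bc$ implies $a\approx b$ or $a\approx c$; m-irreducible (m-atomic) if $(a)$ is maximal among the proper principal ideals of $R$; very strongly irreducible (very strongly atomic) if $a=bc$ implies $a\cong b$ or $a\cong c$. A factorization of a non-unit $x$ is an expression $x=a_1\cdots a_n$, $n\ge1$, with every $a_i$ a non-unit;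 it is an $\alpha$-factorization if every $a_i$ is $\alpha$. $R$ is a: bounded factorization ring (BFR) if for every non-unit $a$ there is a natural number $N(a)$ with $n\le N(a)$ for every factorization $a=a_1\cdots a_n$; $\beta$-finite factorization ring ($\beta$-FFR) if every non-unit has only a finite number of factorizations up to rearrangement and $\beta$; $\beta$-weak finite factorization ring ($\beta$-WFFR) if every non-unit has only finitely many divisors up to $\beta$; $\alpha$-$\beta$-divisor finite ring if every non-unit has only finitely many $\alpha$ divisors up to $\beta$. Divisor graphs: let $A_\emptyset(R)=R\setminus U(R)$ and let $A_\alpha(R)$ be the set of non-units that are $\alpha$. For $\gamma\in\{\emptyset,\alpha\}$ let $A_\gamma^\beta(R)$ be a fixed set of representatives of $A_\gamma(R)$ up to $\beta$. For a non-unit $x$, $V(G_\gamma^\beta(x))=\{a\in A_\gamma^\beta(R): a\mid x\}$. Distinct vertices $a,b$ are joined by an edge iff there is a $\gamma$-factorization (an ordinary factorization if $\gamma=\emptyset$) of the form $x=ab\,a_1\cdots a_m$, $m\ge0$. A vertex $a$ carries $n-1$ loops if there is a $\gamma$-factorization of the form $x=a^n a_1\cdots a_m$ ($m\ge0$, $n$ as large as possible), and infinitely many loops if arbitrarily large powers of $a$ divide $x$. The edge set $E$ includes loops. $\deg(a)$ is the number of vertices different from $a$ adjacent to $a$; $\mathrm{degl}(a)$ is $\deg(a)$ plus the number of loops at $a$.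
   Formalization: "Non-unit" in the BFR, FFR, WFFR, divisor-finite and graph conditions (10)-(19) means nonzero non-unit (0=0···0 breaks the literal claim for fields); edges and loops use factorizations of x up to a unit factor; "up to β" uses β's reflexive closure. *)

theory Defs
  imports
    "HOL-Algebra.Ring_Divisibility"
    "HOL-Algebra.Ideal_Product"
    "HOL-Analysis.Infinite_Sum"
begin

section \<open>Rings and associate relations\<close>

definition nonunits :: "('a, 'b) ring_scheme \<Rightarrow> 'a set" where
  "nonunits R = carrier R - Units R"

definition presimplifiable :: "('a, 'b) ring_scheme \<Rightarrow> bool" where
  "presimplifiable R \<longleftrightarrow>
     (\<forall>x\<in>carrier R. \<forall>y\<in>carrier R. x = x \<otimes>\<^bsub>R\<^esub> y \<longrightarrow> x = \<zero>\<^bsub>R\<^esub> \<or> y \<in> Units R)"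

definition associates :: "('a, 'b) ring_scheme \<Rightarrow> 'a \<Rightarrow> 'a \<Rightarrow> bool" where
  "associates R a b \<longleftrightarrow> PIdl\<^bsub>R\<^esub> a = PIdl\<^bsub>R\<^esub> b"

definition strong_associates :: "('a, 'b) ring_scheme \<Rightarrow> 'a \<Rightarrow> 'a \<Rightarrow> bool" where
  "strong_associates R a b \<longleftrightarrow> (\<exists>u\<in>Units R. a = u \<otimes>\<^bsub>R\<^esub> b)"

definition very_strong_associates :: "('a, 'b) ring_scheme \<Rightarrow> 'a \<Rightarrow> 'a \<Rightarrow> bool" where
  "very_strong_associates R a b \<longleftrightarrow>
     associates R a b \<and>
     (a = \<zero>\<^bsub>R\<^esub> \<and> b = \<zero>\<^bsub>R\<^esub> \<or> (\<forall>r\<in>carrier R. a = r \<otimes>\<^bsub>R\<^esub> b \<longrightarrow> r \<in> Units R))"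


section \<open>Irreducible elements\<close>

definition atomic :: "('a, 'b) ring_scheme \<Rightarrow> 'a \<Rightarrow> bool" where
  "atomic R a \<longleftrightarrow> a \<in> nonunits R \<and>
     (\<forall>b\<in>carrier R. \<forall>c\<in>carrier R. a = b \<otimes>\<^bsub>R\<^esub> c \<longrightarrow> associates R a b \<or> associates R a c)"

definition strongly_atomic :: "('a, 'b) ring_scheme \<Rightarrow> 'a \<Rightarrow> bool" where
  "strongly_atomic R a \<longleftrightarrow> a \<in> nonunits R \<and>
     (\<forall>b\<in>carrier R. \<forall>c\<in>carrier R. a = b \<otimes>\<^bsub>R\<^esub> c \<longrightarrow>
        strong_associates R a b \<or> strong_associates R a c)"

definition m_atomic :: "('a, 'b) ring_scheme \<Rightarrow> 'a \<Rightarrow> bool" where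
  "m_atomic R a \<longleftrightarrow> a \<in> nonunits R \<and>
     (\<forall>b\<in>carrier R. PIdl\<^bsub>R\<^esub> b \<noteq> carrier R \<and> PIdl\<^bsub>R\<^esub> a \<subseteq> PIdl\<^bsub>R\<^esub> b \<longrightarrow> PIdl\<^bsub>R\<^esub> a = PIdl\<^bsub>R\<^esub> b)"

definition very_strongly_atomic :: "('a, 'b) ring_scheme \<Rightarrow> 'a \<Rightarrow> bool" where
  "very_strongly_atomic R a \<longleftrightarrow> a \<in> nonunits R \<and>
     (\<forall>b\<in>carrier R. \<forall>c\<in>carrier R. a = b \<otimes>\<^bsub>R\<^esub> c \<longrightarrow>
        very_strong_associates R a b \<or> very_strong_associates R a c)"


section \<open>Working up to an associate relation\<close>

text \<open>Very strong associateness is symmetric and transitive but not reflexive: a nontrivial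
  idempotent \<open>e = e \<cdot> e\<close> is not a very strong associate of itself. ``Up to \<open>\<beta>\<close>'' therefore always
  refers to the equivalence relation \<open>\<beta>\<^sup>=\<^sup>=\<close>, which is \<open>\<beta>\<close> itself for the other two relations.\<close>

definition finite_up_to :: "('c \<Rightarrow> 'c \<Rightarrow> bool) \<Rightarrow> 'c set \<Rightarrow> bool" where
  "finite_up_to \<beta> A \<longleftrightarrow> (\<exists>F\<subseteq>A. finite F \<and> (\<forall>a\<in>A. \<exists>b\<in>F. \<beta>\<^sup>=\<^sup>= a b))"

definition is_representatives :: "('a \<Rightarrow> 'a \<Rightarrow> bool) \<Rightarrow> 'a set \<Rightarrow> 'a set \<Rightarrow> bool" where
  "is_representatives \<beta> A S \<longleftrightarrow> S \<subseteq> A \<and> (\<forall>a\<in>A. \<exists>!s. s \<in> S \<and> \<beta>\<^sup>=\<^sup>= a s)"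


section \<open>Factorizations\<close>

text \<open>A predicate \<open>\<gamma>\<close> on ring elements restricts the admissible factors; ordinary factorizations
  (the case \<open>\<gamma> = \<emptyset>\<close>) are obtained from \<^term>\<open>any_nonunit\<close>.\<close>

abbreviation any_nonunit :: "'a \<Rightarrow> bool" where
  "any_nonunit \<equiv> (\<lambda>_. True)"

definition factorization ::
  "('a, 'b) ring_scheme \<Rightarrow> ('a \<Rightarrow> bool) \<Rightarrow> 'a \<Rightarrow> 'a list \<Rightarrow> bool" where
  "factorization R \<gamma> x as \<longleftrightarrow>
     as \<noteq> [] \<and> set as \<subseteq> nonunits R \<and> (\<forall>a\<in>set as. \<gamma> a) \<and> foldr (\<otimes>\<^bsub>R\<^esub>) as \<one>\<^bsub>R\<^esub> = x"

definition same_up_to :: "('a \<Rightarrow> 'a \<Rightarrow> bool) \<Rightarrow> 'a list \<Rightarrow> 'a list \<Rightarrow> bool" where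
  "same_up_to \<beta> as bs \<longleftrightarrow> (\<exists>cs. mset cs = mset as \<and> list_all2 \<beta>\<^sup>=\<^sup>= cs bs)"

text \<open>As usual in factorization theory, the finiteness conditions are imposed on \<^emph>\<open>nonzero\<close>
  nonunits only. Since \<open>0 = 0 \<cdots> 0\<close> in every length, no ring would be a BFR or an FFR if zero were
  included, and every element divides zero.\<close>

definition BFR :: "('a, 'b) ring_scheme \<Rightarrow> bool" where
  "BFR R \<longleftrightarrow>
     (\<forall>x\<in>nonunits R - {\<zero>\<^bsub>R\<^esub>}. \<exists>N. \<forall>as. factorization R any_nonunit x as \<longrightarrow> length as \<le> N)"

definition FFR :: "('a, 'b) ring_scheme \<Rightarrow> ('a \<Rightarrow> 'a \<Rightarrow> bool) \<Rightarrow> bool" where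
  "FFR R \<beta> \<longleftrightarrow>
     (\<forall>x\<in>nonunits R - {\<zero>\<^bsub>R\<^esub>}. finite_up_to (same_up_to \<beta>) {as. factorization R any_nonunit x as})"

definition WFFR :: "('a, 'b) ring_scheme \<Rightarrow> ('a \<Rightarrow> 'a \<Rightarrow> bool) \<Rightarrow> bool" where
  "WFFR R \<beta> \<longleftrightarrow>
     (\<forall>x\<in>nonunits R - {\<zero>\<^bsub>R\<^esub>}. finite_up_to \<beta> {d \<in> carrier R. d divides\<^bsub>R\<^esub> x})"

definition divisor_finite ::
  "('a, 'b) ring_scheme \<Rightarrow> ('a \<Rightarrow> bool) \<Rightarrow> ('a \<Rightarrow> 'a \<Rightarrow> bool) \<Rightarrow> bool" where
  "divisor_finite R \<alpha> \<beta> \<longleftrightarrow>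
     (\<forall>x\<in>nonunits R - {\<zero>\<^bsub>R\<^esub>}. finite_up_to \<beta> {d \<in> carrier R. \<alpha> d \<and> d divides\<^bsub>R\<^esub> x})"


section \<open>Powers of ideals\<close>

primrec ideal_pow :: "('a, 'b) ring_scheme \<Rightarrow> 'a set \<Rightarrow> nat \<Rightarrow> 'a set" where
  "ideal_pow R I 0 = carrier R"
| "ideal_pow R I (Suc n) = ideal_prod R (ideal_pow R I n) I"

definition principal_powers_meet_zero :: "('a, 'b) ring_scheme \<Rightarrow> bool" where
  "principal_powers_meet_zero R \<longleftrightarrow>
     (\<forall>y\<in>nonunits R. (\<Inter>n\<in>{1::nat..}. PIdl\<^bsub>R\<^esub> (y [^]\<^bsub>R\<^esub> n)) = {\<zero>\<^bsub>R\<^esub>})"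

definition ideal_powers_meet_zero :: "('a, 'b) ring_scheme \<Rightarrow> bool" where
  "ideal_powers_meet_zero R \<longleftrightarrow>
     (\<forall>I. ideal I R \<and> I \<noteq> carrier R \<longrightarrow> (\<Inter>n\<in>{1..}. ideal_pow R I n) = {\<zero>\<^bsub>R\<^esub>})"


section \<open>Divisor graphs\<close>

text \<open>\<open>S\<close> is always a set of representatives of \<^term>\<open>graph_elements R \<gamma>\<close> up to \<open>\<beta>\<close>; the graph
  depends on \<open>\<beta>\<close> only through \<open>S\<close>.\<close>

definition graph_elements :: "('a, 'b) ring_scheme \<Rightarrow> ('a \<Rightarrow> bool) \<Rightarrow> 'a set" where
  "graph_elements R \<gamma> = {a \<in> nonunits R. \<gamma> a}"

definition vertices :: "('a, 'b) ring_scheme \<Rightarrow> 'a set \<Rightarrow> 'a \<Rightarrow> 'a set" where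
  "vertices R S x = {a \<in> S. a divides\<^bsub>R\<^esub> x}"

text \<open>Factorizations of \<open>x\<close> are read up to a unit factor: \<open>a\<close> and \<open>b\<close> are adjacent if
  \<open>u x = a b a\<^sub>1 \<cdots> a\<^sub>m\<close> for some unit \<open>u\<close>. For \<open>m \<ge> 1\<close> the unit can be absorbed into \<open>a\<^sub>1\<close>, so this
  only matters for \<open>m = 0\<close>. There it is needed because the vertices are fixed representatives:
  if \<open>x = p q\<close>, the product of the representatives of \<open>p\<close> and \<open>q\<close> is in general only an associate
  of \<open>x\<close>. Without the unit, a bad choice of representatives can remove almost all edges. In the
  Artinian local ring \<open>\<real> + X \<complex>[X] / (X\<^sup>3)\<close>, where \<open>X\<^sup>2\<close> has infinitely many nonassociate divisors
  \<open>c X\<close>, representatives \<open>r X\<close> can be chosen so that every nonzero nonunit has at most one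
  factorization into two of them.\<close>

definition adjacent ::
  "('a, 'b) ring_scheme \<Rightarrow> ('a \<Rightarrow> bool) \<Rightarrow> 'a \<Rightarrow> 'a \<Rightarrow> 'a \<Rightarrow> bool" where
  "adjacent R \<gamma> x a b \<longleftrightarrow>
     a \<noteq> b \<and> (\<exists>u\<in>Units R. \<exists>as. factorization R \<gamma> (u \<otimes>\<^bsub>R\<^esub> x) (a # b # as))"

definition num_loops ::
  "('a, 'b) ring_scheme \<Rightarrow> ('a \<Rightarrow> bool) \<Rightarrow> 'a \<Rightarrow> 'a \<Rightarrow> enat" where
  "num_loops R \<gamma> x a =
     (if \<forall>N::nat. \<exists>n\<ge>N. (a [^]\<^bsub>R\<^esub> n) divides\<^bsub>R\<^esub> x then \<infinity>
      else (SUP n\<in>{n. n \<ge> 1 \<and>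
                     (\<exists>u\<in>Units R. \<exists>as. factorization R \<gamma> (u \<otimes>\<^bsub>R\<^esub> x) (replicate n a @ as))}.
              enat (n - 1)))"

datatype 'a edge = Link "'a set" | Loop 'a nat

definition edges :: "('a, 'b) ring_scheme \<Rightarrow> ('a \<Rightarrow> bool) \<Rightarrow> 'a set \<Rightarrow> 'a \<Rightarrow> 'a edge set" where
  "edges R \<gamma> S x =
     {Link {a, b} | a b. a \<in> vertices R S x \<and> b \<in> vertices R S x \<and> adjacent R \<gamma> x a b} \<union>
     {Loop a i | a i. a \<in> vertices R S x \<and> enat i < num_loops R \<gamma> x a}"

definition deg :: "('a, 'b) ring_scheme \<Rightarrow> ('a \<Rightarrow> bool) \<Rightarrow> 'a set \<Rightarrow> 'a \<Rightarrow> 'a \<Rightarrow> enat" where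
  "deg R \<gamma> S x a =
     (let B = {b \<in> vertices R S x. adjacent R \<gamma> x a b} in if finite B then enat (card B) else \<infinity>)"

definition degl :: "('a, 'b) ring_scheme \<Rightarrow> ('a \<Rightarrow> bool) \<Rightarrow> 'a set \<Rightarrow> 'a \<Rightarrow> 'a \<Rightarrow> enat" where
  "degl R \<gamma> S x a = deg R \<gamma> S x a + num_loops R \<gamma> x a"

definition finite_vertices :: "('a, 'b) ring_scheme \<Rightarrow> 'a set \<Rightarrow> bool" where
  "finite_vertices R S \<longleftrightarrow> (\<forall>x\<in>nonunits R - {\<zero>\<^bsub>R\<^esub>}. finite (vertices R S x))"

end

theory Submission
  imports Defs
begin

text \<open>
  The conditions compared with the FFR property combine a bound on the length of factorizations with
  a finiteness condition on divisors, or bound the divisor graph.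

  The conditions that exclude unbounded factorizations, namely BFR, presimplifiable, and the two
  conditions on intersections of powers, are equivalent over a Noetherian ring. The easy direction
  is that a relation \<open>x = x y\<close> with \<open>x \<noteq> 0\<close> and \<open>y\<close> a nonunit gives \<open>x = x y\<^sup>n\<close> for all
  \<open>n\<close>, so \<open>x\<close> lies in every \<open>(y\<^sup>n)\<close> and has arbitrarily long factorizations. Conversely,
  Krull's intersection theorem (\<open>krull_intersection\<close>) turns \<open>x \<in> \<Inter> I\<^sup>n\<close> into \<open>x = i x\<close> with
  \<open>i \<in> I\<close>, which in a presimplifiable ring forces \<open>x = 0\<close>. For the bound on lengths, every nonunit
  factor of \<open>x \<noteq> 0\<close> in a presimplifiable ring is a zero divisor modulo \<open>(x)\<close>, and in a
  Noetherian ring these zero divisors lie in finitely many proper ideals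
  (\<open>zero_divisors_covered\<close>). A long factorization has many factors in one of these ideals
  \<open>P\<close>, hence puts \<open>x\<close> into a high power of \<open>P\<close>, while \<open>\<Inter> P\<^sup>n = 0\<close>.

  The conditions that count divisors all count principal ideals. In a presimplifiable ring the three
  associate relations coincide with equality of principal ideals (\<open>associate_relations\<close>), so
  finiteness up to \<open>\<beta>\<close> and finiteness of a set of representatives both say that the set
  \<open>divisor_ideals\<close> of principal ideals generated by divisors of \<open>x\<close> is finite. Counting only
  the irreducible divisors gives the same condition: in a BFR every nonunit divisor of
  \<open>x \<noteq> 0\<close> is a product of boundedly many irreducible divisors of \<open>x\<close>
  (\<open>finite_divisor_ideals_if_atoms\<close>). The FFR property is the conjunction of bounded lengths and
  finitely many divisor ideals (\<open>FFR_iff_finite_divisor_ideals\<close>).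

  The two graph conditions on edges and degrees are equivalent to this conjunction
  as well. If \<open>x = x y\<close> with \<open>x \<noteq> 0\<close> and \<open>y\<close> a nonunit, the representative of \<open>y\<close>
  carries infinitely many loops; and every vertex that does not generate \<open>(x)\<close> has an incident
  edge, since its cofactor in \<open>x\<close> is a nonunit, so finitely many edges allow only finitely many
  vertices up to associates.\<close>

text \<open>The symbol \<open><+>\<close> stands for the sum of two ideals below.\<close>

no_notation Sum_Type.Plus (infixr \<open><+>\<close> 65)

section \<open>Ideals of Noetherian rings\<close>

locale noetherian_cring = noetherian_ring + cring

text \<open>The ascending chain condition in the form of the maximum condition, by Zorn's lemma; it also serves
as the principle of Noetherian induction below.\<close>

lemma (in noetherian_ring) exists_maximal_ideal_in_family:
  assumes "\<A> \<noteq> {}" and "\<And>I. I \<in> \<A> \<Longrightarrow> ideal I R"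
  obtains M where "M \<in> \<A>" and "\<And>I. I \<in> \<A> \<Longrightarrow> M \<subseteq> I \<Longrightarrow> I = M"
proof -
  have "\<Union>\<C> \<in> \<A>" if "\<C> \<noteq> {}" "subset.chain \<A> \<C>" for \<C>
  proof -
    have "subset.chain {I. ideal I R} \<C>" using that assms(2) unfolding subset_chain_def by blast
    with that have "\<Union>\<C> \<in> \<C>" by (intro ideal_chain_is_trivial)
    with that show ?thesis unfolding subset_chain_def by blast
  qed
  then have "\<exists>M\<in>\<A>. \<forall>I\<in>\<A>. M \<subseteq> I \<longrightarrow> I = M"
    by (intro subset_Zorn_nonempty assms(1))
  with that show ?thesis by blast
qed

lemma (in ring) ideal_add_closed:
  assumes "ideal I R" "a \<in> I" "b \<in> I"
  shows "a \<oplus> b \<in> I"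
  using assms by (simp add: additive_subgroup.a_closed ideal.axioms(1))

lemma (in ring) ideal_minus_closed:
  assumes "ideal I R" "a \<in> I"
  shows "\<ominus> a \<in> I"
  using assms by (simp add: additive_subgroup.a_inv_closed ideal.axioms(1))

lemma (in ring) ideal_zero:
  assumes "ideal I R"
  shows "\<zero> \<in> I"
  using assms by (simp add: additive_subgroup.zero_closed ideal.axioms(1))

lemma (in ring) ideal_add_cancel:
  assumes I: "ideal I R" and "a \<oplus> b \<in> I" "b \<in> I" and a: "a \<in> carrier R"
  shows "a \<in> I"
proof -
  have b: "b \<in> carrier R" using assms ideal.Icarr by metis
  have "(a \<oplus> b) \<oplus> \<ominus> b \<in> I"
    by (intro ideal_add_closed ideal_minus_closed assms)
  also have "(a \<oplus> b) \<oplus> \<ominus> b = a" using a b by algebra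
  finally show ?thesis .
qed

lemma (in ring) set_add_upper:
  assumes "ideal I R" "ideal J R"
  shows "I \<subseteq> I <+> J" "J \<subseteq> I <+> J"
proof -
  have "a \<oplus> \<zero> \<in> I <+> J" if "a \<in> I" for a
    using that ideal_zero[OF assms(2)] unfolding set_add_def' by blast
  then show "I \<subseteq> I <+> J" using ideal.Icarr[OF assms(1)] by fastforce
  have "\<zero> \<oplus> a \<in> I <+> J" if "a \<in> J" for a
    using that ideal_zero[OF assms(1)] unfolding set_add_def' by blast
  then show "J \<subseteq> I <+> J" using ideal.Icarr[OF assms(2)] by fastforce
qed

lemma (in ring) set_add_least:
  assumes "I \<subseteq> K" "J \<subseteq> K" "ideal K R"
  shows "I <+> J \<subseteq> K"
  using assms(1,2) ideal_add_closed[OF assms(3)] unfolding set_add_def' by auto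

definition colon :: "('a, 'b) ring_scheme \<Rightarrow> 'a set \<Rightarrow> 'a \<Rightarrow> 'a set" where
  "colon R J b = {r \<in> carrier R. r \<otimes>\<^bsub>R\<^esub> b \<in> J}"

lemma (in cring) colon_ideal:
  assumes J: "ideal J R" and b: "b \<in> carrier R"
  shows "ideal (colon R J b) R"
proof (intro idealI ring_axioms)
  show "subgroup (colon R J b) (add_monoid R)"
  proof (rule add.subgroupI)
    show "colon R J b \<noteq> {}"
      using ideal_zero[OF J] b by (auto simp: colon_def intro: exI[of _ "\<zero>"])
  qed (use b in \<open>auto simp: colon_def l_minus l_distr intro: ideal_minus_closed[OF J] ideal_add_closed[OF J]\<close>)
next
  fix a r assume a: "a \<in> colon R J b" and r: "r \<in> carrier R"
  then have "r \<otimes> (a \<otimes> b) \<in> J" using ideal.I_l_closed[OF J] by (auto simp: colon_def)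
  then show ra: "r \<otimes> a \<in> colon R J b" using a r b by (auto simp: colon_def m_assoc)
  then show "a \<otimes> r \<in> colon R J b" using a r by (auto simp: colon_def m_comm)
qed

section \<open>Powers of ideals\<close>

lemma (in ring) ideal_pow_ideal:
  assumes "ideal I R"
  shows "ideal (ideal_pow R I n) R"
  by (induction n) (auto intro: ideal_prod_is_ideal assms oneideal)

lemma (in ring) ideal_prod_least:
  assumes "\<And>i j. i \<in> I \<Longrightarrow> j \<in> J \<Longrightarrow> i \<otimes> j \<in> K" and "ideal K R"
  shows "I \<cdot> J \<subseteq> K"
proof
  fix s assume "s \<in> I \<cdot> J"
  then show "s \<in> K"
    by (induction rule: ideal_prod.induct) (auto intro: assms(1) ideal_add_closed[OF assms(2)])
qed

lemma ideal_prod_mono: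
  assumes "I \<subseteq> I'" "J \<subseteq> J'"
  shows "ideal_prod R I J \<subseteq> ideal_prod R I' J'"
proof
  fix s assume "s \<in> ideal_prod R I J"
  then show "s \<in> ideal_prod R I' J'"
    using assms by (induction rule: ideal_prod.induct) (auto intro: ideal_prod.intros)
qed

lemma ideal_pow_mono: "I \<subseteq> J \<Longrightarrow> ideal_pow R I n \<subseteq> ideal_pow R J n"
  by (induction n) (simp_all add: ideal_prod_mono)

lemma (in cring) ideal_pow_add:
  assumes "ideal I R"
  shows "ideal_pow R I (m + n) = ideal_pow R I m \<cdot> ideal_pow R I n"
  by (induction n) (simp_all add: ideal_prod_one ideal_pow_ideal assms ideal_prod_assoc)

lemma (in cring) ideal_pow_mult:
  assumes "ideal I R"
  shows "ideal_pow R I (m * n) = ideal_pow R (ideal_pow R I m) n"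
proof (induction n)
  case (Suc n)
  have "ideal_pow R I (m * Suc n) = ideal_pow R I (m * n + m)" by (simp add: add.commute)
  also have "\<dots> = ideal_pow R (ideal_pow R I m) (Suc n)"
    using assms Suc by (simp add: ideal_pow_add)
  finally show ?case .
qed simp

lemma (in cring) ideal_pow_antimono:
  assumes "ideal I R" "m \<le> n"
  shows "ideal_pow R I n \<subseteq> ideal_pow R I m"
proof -
  have "ideal_pow R I (m + (n - m)) \<subseteq> ideal_pow R I m"
    using ideal_prod_inter[OF ideal_pow_ideal ideal_pow_ideal] assms(1) by (auto simp: ideal_pow_add)
  then show ?thesis using assms(2) by simp
qed

lemma (in cring) ideal_pow_one:
  assumes "ideal I R"
  shows "ideal_pow R I 1 = I"
  using assms by (simp add: ideal_prod_commute[OF oneideal] ideal_prod_one)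

lemma (in cring) ideal_prod_principal:
  assumes "a \<in> carrier R" "b \<in> carrier R"
  shows "(PIdl a) \<cdot> (PIdl b) = PIdl (a \<otimes> b)"
proof -
  have ab: "ideal (PIdl (a \<otimes> b)) R" by (intro cgenideal_ideal) (use assms in auto)
  have "(PIdl a) \<cdot> (PIdl b) = Idl (PIdl a <#> PIdl b)"
    by (intro ideal_prod_eq_genideal cgenideal_ideal assms)
  also have "\<dots> = Idl (PIdl (a \<otimes> b))" using assms by (simp add: cgenideal_prod)
  also have "\<dots> = PIdl (a \<otimes> b)"
    using ab by (intro equalityI genideal_minimal genideal_self order_refl)
      (auto intro: additive_subgroup.a_Hcarr ideal.axioms(1))
  finally show ?thesis .
qed

lemma (in cring) cgenideal_one: "PIdl \<one> = carrier R"
  using ideal_eq_carrier_iff[OF one_closed] by simp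

lemma (in cring) ideal_pow_principal:
  assumes "a \<in> carrier R"
  shows "ideal_pow R (PIdl a) n = PIdl (a [^] n)"
  by (induction n) (use assms in \<open>simp_all add: cgenideal_one ideal_prod_principal\<close>)

text \<open>Expanding a product of \<open>n\<close> elements of \<open>I + J\<close>, the only term without a factor in \<open>J\<close> is the one in
\<open>I\<^sup>n\<close>.\<close>

lemma (in cring) ideal_pow_sum_subset:
  assumes I: "ideal I R" and J: "ideal J R"
  shows "ideal_pow R (I <+> J) n \<subseteq> ideal_pow R I n <+> J"
proof (induction n)
  case 0
  show ?case using set_add_upper[OF oneideal J] by simp
next
  case (Suc n)
  let ?S = "ideal_pow R I (Suc n) <+> J"
  have S: "ideal ?S R" by (intro add_ideals ideal_pow_ideal I J)
  have "(ideal_pow R I n <+> J) \<cdot> (I <+> J) \<subseteq> ?S"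
  proof (rule ideal_prod_least[OF _ S])
    fix s t assume "s \<in> ideal_pow R I n <+> J" "t \<in> I <+> J"
    then obtain p j i k where *: "p \<in> ideal_pow R I n" "j \<in> J" "i \<in> I" "k \<in> J"
      and s: "s = p \<oplus> j" and t: "t = i \<oplus> k" unfolding set_add_def' by auto
    have c: "p \<in> carrier R" "j \<in> carrier R" "i \<in> carrier R" "k \<in> carrier R"
      using * ideal.Icarr[OF I] ideal.Icarr[OF J] ideal.Icarr[OF ideal_pow_ideal[OF I]] by blast+
    have eq: "s \<otimes> t = p \<otimes> i \<oplus> (p \<otimes> k \<oplus> j \<otimes> t)" unfolding s t using c by algebra
    have "p \<otimes> i \<in> ideal_pow R I (Suc n)" using * by (auto intro: ideal_prod.prod)
    moreover have "p \<otimes> k \<oplus> j \<otimes> t \<in> J"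
      using * c t by (intro ideal_add_closed[OF J] ideal.I_l_closed[OF J] ideal.I_r_closed[OF J]) auto
    ultimately show "s \<otimes> t \<in> ?S" unfolding eq set_add_def' by blast
  qed
  with ideal_prod_mono[OF Suc order_refl, of R "I <+> J"] show ?case by simp
qed

section \<open>Krull's intersection theorem\<close>

text \<open>Instead of a binomial estimate on a finite set of generators, the proof takes an ideal \<open>K \<subseteq> I\<close> that is
maximal among those with a power inside \<open>L\<close>. Adjoining \<open>a \<in> I\<close> keeps this property: if
\<open>K\<^sup>n \<subseteq> L\<close> and \<open>a\<^sup>m \<in> L\<close>, then \<open>(K + (a))\<^sup>n\<^sup>m \<subseteq> ((a) + L)\<^sup>m \<subseteq> (a\<^sup>m) + L = L\<close>.\<close>

lemma (in noetherian_cring) ideal_pow_subset_if_nil: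
  assumes I: "ideal I R" and L: "ideal L R"
    and nil: "\<And>a. a \<in> I \<Longrightarrow> \<exists>n::nat. a [^] n \<in> L"
  shows "\<exists>n. ideal_pow R I n \<subseteq> L"
proof -
  define \<A> where "\<A> = {K. ideal K R \<and> K \<subseteq> I \<and> (\<exists>n. ideal_pow R K n \<subseteq> L)}"
  have "ideal_pow R {\<zero>} 1 \<subseteq> L" using ideal_zero[OF L] by (simp only: ideal_pow_one[OF zeroideal]) simp
  then have ne: "{\<zero>} \<in> \<A>" unfolding \<A>_def using ideal_zero[OF I] zeroideal by blast
  obtain K where K: "K \<in> \<A>" and max: "\<And>K'. K' \<in> \<A> \<Longrightarrow> K \<subseteq> K' \<Longrightarrow> K' = K"
    by (rule exists_maximal_ideal_in_family[of \<A>]) (use ne in \<open>auto simp: \<A>_def\<close>)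
  then obtain n where n: "ideal K R" "K \<subseteq> I" "ideal_pow R K n \<subseteq> L" unfolding \<A>_def by blast
  have "a \<in> K" if a: "a \<in> I" for a
  proof -
    obtain m :: nat where m: "a [^] m \<in> L" using nil a by blast
    have ac: "a \<in> carrier R" using I a ideal.Icarr by metis
    let ?A = "PIdl a" and ?K = "K <+> PIdl a"
    have A: "ideal ?A R" using ac by (rule cgenideal_ideal)
    have K': "ideal ?K R" by (intro add_ideals n A)
    have "ideal_pow R ?K (n * m) = ideal_pow R (ideal_pow R ?K n) m" by (rule ideal_pow_mult[OF K'])
    also have "\<dots> \<subseteq> ideal_pow R (?A <+> L) m"
    proof (rule ideal_pow_mono)
      have "ideal_pow R ?K n \<subseteq> ideal_pow R K n <+> ?A" by (rule ideal_pow_sum_subset[OF n(1) A])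
      also have "\<dots> \<subseteq> ?A <+> L"
        using set_add_upper[OF A L] n(3) by (intro set_add_least add_ideals A L) auto
      finally show "ideal_pow R ?K n \<subseteq> ?A <+> L" .
    qed
    also have "\<dots> \<subseteq> ideal_pow R ?A m <+> L" by (rule ideal_pow_sum_subset[OF A L])
    also have "\<dots> \<subseteq> L"
      using m ac by (intro set_add_least L) (simp_all add: ideal_pow_principal cgenideal_minimal[OF L])
    finally have "ideal_pow R ?K (n * m) \<subseteq> L" .
    moreover have "?K \<subseteq> I" by (intro set_add_least n I cgenideal_minimal a)
    ultimately have "?K \<in> \<A>" unfolding \<A>_def using K' by blast
    then have "?K = K" by (intro max set_add_upper n A)
    then show ?thesis using set_add_upper(2)[OF n(1) A] cgenideal_self[OF ac] by blast
  qed
  then have "K = I" using n by blast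
  with n show ?thesis by blast
qed

lemma (in cring) ideal_prod_principalE:
  assumes I: "ideal I R" and x: "x \<in> carrier R" and "s \<in> I \<cdot> (PIdl x)"
  shows "\<exists>i\<in>I. s = i \<otimes> x"
  using assms(3)
proof (induction rule: ideal_prod.induct)
  case (prod i j)
  then obtain r where "r \<in> carrier R" "j = r \<otimes> x" unfolding cgenideal_def by blast
  then show ?case using prod x ideal.Icarr[OF I] ideal.I_r_closed[OF I]
    by (intro bexI[of _ "i \<otimes> r"]) (auto simp: m_assoc)
next
  case (sum s t)
  then obtain i j where "i \<in> I" "j \<in> I" "s = i \<otimes> x" "t = j \<otimes> x" by blast
  then show ?case using x ideal.Icarr[OF I] ideal_add_closed[OF I]
    by (intro bexI[of _ "i \<oplus> j"]) (auto simp: l_distr)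
qed

text \<open>Krull's intersection theorem for a single element, in Herstein's manner. Choose
\<open>L \<supseteq> I x\<close> maximal with \<open>L \<inter> (x) = I x\<close>. If some \<open>I\<^sup>n\<close> is contained in \<open>L\<close>, then
\<open>x \<in> I\<^sup>n\<close> gives \<open>x \<in> L \<inter> (x) = I x\<close>. So it suffices that every \<open>a \<in> I\<close> has a power in \<open>L\<close>: once the
chain of ideals \<open>(L : a\<^sup>n)\<close> is stable at \<open>n\<close>, the ideal \<open>L + (a\<^sup>n)\<close> still meets \<open>(x)\<close> in \<open>I x\<close>, and
maximality yields \<open>a\<^sup>n \<in> L\<close>.\<close>

lemma (in noetherian_cring) krull_intersection:
  assumes I: "ideal I R" and x: "x \<in> carrier R" and "\<And>n. x \<in> ideal_pow R I n"
  obtains i where "i \<in> I" and "x = i \<otimes> x"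
proof -
  let ?X = "PIdl x"
  have X: "ideal ?X R" by (rule cgenideal_ideal[OF x])
  have IX: "ideal (I \<cdot> ?X) R" by (rule ideal_prod_is_ideal[OF I X])
  define \<A> where "\<A> = {L. ideal L R \<and> I \<cdot> ?X \<subseteq> L \<and> L \<inter> ?X \<subseteq> I \<cdot> ?X}"
  have ne: "I \<cdot> ?X \<in> \<A>" unfolding \<A>_def using IX by blast
  obtain L where "L \<in> \<A>" and max: "\<And>K. K \<in> \<A> \<Longrightarrow> L \<subseteq> K \<Longrightarrow> K = L"
    by (rule exists_maximal_ideal_in_family[of \<A>]) (use ne in \<open>auto simp: \<A>_def\<close>)
  then have L: "ideal L R" and IXL: "I \<cdot> ?X \<subseteq> L" and LX: "L \<inter> ?X \<subseteq> I \<cdot> ?X"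
    unfolding \<A>_def by blast+
  have "\<exists>n::nat. a [^] n \<in> L" if a: "a \<in> I" for a
  proof -
    have ac: "a \<in> carrier R" using I a ideal.Icarr by metis
    define C where "C = (\<lambda>n::nat. colon R L (a [^] n))"
    have C: "ideal (C n) R" for n unfolding C_def using ac by (intro colon_ideal L) auto
    obtain n where n: "\<And>m. C n \<subseteq> C m \<Longrightarrow> C m = C n"
    proof (rule exists_maximal_ideal_in_family[of "range C"])
      fix M assume "M \<in> range C" and M: "\<And>I. I \<in> range C \<Longrightarrow> M \<subseteq> I \<Longrightarrow> I = M"
      then obtain n where "M = C n" by blast
      with M show thesis by (intro that) auto
    qed (use C in auto)
    have "C n \<subseteq> C (Suc n)"
    proof
      fix r assume r: "r \<in> C n"
      then have "(r \<otimes> a [^] n) \<otimes> a \<in> L"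
        using ideal.I_r_closed[OF L] ac by (auto simp: C_def colon_def)
      then show "r \<in> C (Suc n)" using r ac by (auto simp: C_def colon_def m_assoc)
    qed
    then have stable: "C (Suc n) = C n" by (rule n)
    let ?A = "PIdl (a [^] n)"
    have A: "ideal ?A R" using ac by (intro cgenideal_ideal) auto
    have "(L <+> ?A) \<inter> ?X \<subseteq> I \<cdot> ?X"
    proof
      fix y assume y: "y \<in> (L <+> ?A) \<inter> ?X"
      then obtain l r where l: "l \<in> L" and r: "r \<in> carrier R" and y_eq: "y = l \<oplus> r \<otimes> a [^] n"
        unfolding set_add_def' cgenideal_def by auto
      have lc: "l \<in> carrier R" using L l ideal.Icarr by metis
      \<comment> \<open>Since \<open>y \<in> (x)\<close>, multiplying by \<open>a \<in> I\<close> moves it into \<open>I x \<subseteq> L\<close>; stability of the colon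
        ideals then cancels this extra factor \<open>a\<close>.\<close>
      have "a \<otimes> y \<in> L" using IXL ideal_prod.prod[OF a, of y ?X R] y by blast
      also have "a \<otimes> y = r \<otimes> a [^] Suc n \<oplus> a \<otimes> l"
        unfolding y_eq nat_pow_Suc using lc r ac nat_pow_closed[OF ac, of n] by algebra
      finally have "r \<otimes> a [^] Suc n \<in> L"
        by (rule ideal_add_cancel[OF L]) (use L l ac r in \<open>auto intro: ideal.I_l_closed\<close>)
      then have "r \<in> C (Suc n)" using r by (simp add: C_def colon_def)
      then have "r \<in> C n" unfolding stable .
      then have "r \<otimes> a [^] n \<in> L" by (simp add: C_def colon_def)
      then have "y \<in> L" unfolding y_eq using l by (intro ideal_add_closed[OF L])
      then show "y \<in> I \<cdot> ?X" using y by (intro subsetD[OF LX]) simp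
    qed
    then have "L <+> ?A \<in> \<A>"
      unfolding \<A>_def using subset_trans[OF IXL set_add_upper(1)[OF L A]] add_ideals[OF L A] by simp
    then have "L <+> ?A = L" by (intro max set_add_upper L A)
    then have "?A \<subseteq> L" using set_add_upper(2)[OF L A] by simp
    then have "a [^] n \<in> L" by (rule subsetD) (use ac in \<open>simp add: cgenideal_self\<close>)
    then show ?thesis ..
  qed
  from ideal_pow_subset_if_nil[OF I L this] obtain n where "ideal_pow R I n \<subseteq> L" by blast
  then have "x \<in> L" using assms(3) by blast
  then have "x \<in> I \<cdot> ?X" using cgenideal_self[OF x] by (intro subsetD[OF LX]) simp
  then obtain i where "i \<in> I" "x = i \<otimes> x" using ideal_prod_principalE[OF I x] by blast
  with that show ?thesis .
qed

section \<open>Zero divisors modulo an ideal\<close>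

text \<open>The ideals in \<open>\<F>\<close> play the role of the associated primes of \<open>R / J\<close>; they are found by Noetherian
induction on \<open>J\<close>. Take \<open>P = (J : b)\<close> maximal among the ideals \<open>(J : c)\<close> with \<open>c \<notin> J\<close>.
A zero divisor \<open>a\<close> modulo \<open>J\<close>, say \<open>a c \<in> J\<close> with \<open>c \<notin> J\<close>, is a zero divisor modulo \<open>J + (b)\<close> if
\<open>c \<notin> J + (b)\<close>. Otherwise \<open>c\<close> is congruent to some \<open>r b\<close> modulo \<open>J\<close>, and \<open>a \<in> (J : r b) = P\<close>
by maximality of \<open>P\<close>.\<close>

lemma (in noetherian_cring) zero_divisors_covered:
  assumes "ideal J R"
  shows "\<exists>\<F>. finite \<F> \<and> (\<forall>P\<in>\<F>. ideal P R \<and> P \<noteq> carrier R) \<and>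
    (\<forall>a\<in>carrier R. \<forall>c\<in>carrier R - J. a \<otimes> c \<in> J \<longrightarrow> a \<in> \<Union>\<F>)"
proof (rule ccontr)
  assume not_covered: "\<not> ?thesis"
  define cov where "cov J \<F> \<longleftrightarrow> finite \<F> \<and> (\<forall>P\<in>\<F>. ideal P R \<and> P \<noteq> carrier R) \<and>
    (\<forall>a\<in>carrier R. \<forall>c\<in>carrier R - J. a \<otimes> c \<in> J \<longrightarrow> a \<in> \<Union>\<F>)" for J \<F>
  have ne: "{J. ideal J R \<and> (\<nexists>\<F>. cov J \<F>)} \<noteq> {}"
    using not_covered assms by (auto simp: cov_def)
  obtain J where J: "ideal J R" and bad: "\<nexists>\<F>. cov J \<F>"
    and max: "\<And>K. ideal K R \<Longrightarrow> \<nexists>\<F>. cov K \<F> \<Longrightarrow> J \<subseteq> K \<Longrightarrow> K = J"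
    by (rule exists_maximal_ideal_in_family[OF ne]) auto
  have "carrier R - J \<noteq> {}"
  proof
    assume "carrier R - J = {}"
    then have "cov J {}" unfolding cov_def by blast
    with bad show False by blast
  qed
  then have ne': "colon R J ` (carrier R - J) \<noteq> {}" by blast
  obtain P where "P \<in> colon R J ` (carrier R - J)"
    and P_max: "\<And>I. I \<in> colon R J ` (carrier R - J) \<Longrightarrow> P \<subseteq> I \<Longrightarrow> I = P"
    by (rule exists_maximal_ideal_in_family[OF ne']) (auto intro: colon_ideal[OF J])
  then obtain b where b: "b \<in> carrier R" "b \<notin> J" and P: "P = colon R J b" by blast
  have P_ideal: "ideal P R" unfolding P by (rule colon_ideal[OF J b(1)])
  have "\<one> \<notin> P" unfolding P colon_def using b by simp
  then have P_proper: "P \<noteq> carrier R" by auto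
  let ?B = "PIdl b"
  have B: "ideal ?B R" by (rule cgenideal_ideal[OF b(1)])
  have "J <+> ?B \<noteq> J" using set_add_upper(2)[OF J B] cgenideal_self[OF b(1)] b by blast
  then obtain \<F> where \<F>: "cov (J <+> ?B) \<F>"
    using max[OF add_ideals[OF J B]] set_add_upper(1)[OF J B] by blast
  then have \<F>_ideals: "finite \<F>" "\<And>Q. Q \<in> \<F> \<Longrightarrow> ideal Q R \<and> Q \<noteq> carrier R"
    and \<F>_covers: "\<And>a c. a \<in> carrier R \<Longrightarrow> c \<in> carrier R - (J <+> ?B) \<Longrightarrow> a \<otimes> c \<in> J <+> ?B \<Longrightarrow> a \<in> \<Union>\<F>"
    unfolding cov_def by blast+
  have "a \<in> \<Union>(insert P \<F>)"
    if a: "a \<in> carrier R" and c: "c \<in> carrier R - J" and ac: "a \<otimes> c \<in> J" for a c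
  proof (cases "c \<in> J <+> ?B")
    case False
    then have "a \<in> \<Union>\<F>" using c ac set_add_upper(1)[OF J B] by (intro \<F>_covers[OF a, of c]) auto
    then show ?thesis by simp
  next
    case True
    then obtain j r where j: "j \<in> J" and r: "r \<in> carrier R" and c_eq: "c = j \<oplus> r \<otimes> b"
      unfolding set_add_def' cgenideal_def by auto
    have jc: "j \<in> carrier R" using J j ideal.Icarr by metis
    have "a \<otimes> c = a \<otimes> (r \<otimes> b) \<oplus> a \<otimes> j" unfolding c_eq using a b r jc by algebra
    with ac have "a \<otimes> (r \<otimes> b) \<oplus> a \<otimes> j \<in> J" by simp
    then have "a \<otimes> (r \<otimes> b) \<in> J"
      by (rule ideal_add_cancel[OF J]) (use a b r in \<open>simp_all add: ideal.I_l_closed[OF J j]\<close>)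
    moreover have rb: "r \<otimes> b \<in> carrier R - J"
    proof -
      have "r \<otimes> b \<notin> J" using ideal_add_closed[OF J j, of "r \<otimes> b"] c unfolding c_eq by blast
      then show ?thesis using r b by simp
    qed
    moreover have "colon R J (r \<otimes> b) = P"
    proof (rule P_max)
      show "colon R J (r \<otimes> b) \<in> colon R J ` (carrier R - J)" using rb by blast
      show "P \<subseteq> colon R J (r \<otimes> b)"
      proof
        fix s assume s: "s \<in> P"
        then have "r \<otimes> (s \<otimes> b) \<in> J" using r ideal.I_l_closed[OF J] by (auto simp: P colon_def)
        then show "s \<in> colon R J (r \<otimes> b)" using s r b by (auto simp: P colon_def m_lcomm)
      qed
    qed
    ultimately have "a \<in> P" using a by (auto simp: colon_def)
    then show ?thesis by blast
  qed
  then have "cov J (insert P \<F>)"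
    unfolding cov_def using \<F>_ideals P_ideal P_proper by simp
  with bad show False by blast
qed

section \<open>Presimplifiable Noetherian rings\<close>

lemma (in cring) proper_ideal_no_units:
  assumes "ideal I R" "I \<noteq> carrier R" "a \<in> I"
  shows "a \<notin> Units R"
proof
  assume "a \<in> Units R"
  moreover have "a \<in> carrier R" using assms ideal.Icarr by metis
  ultimately have "carrier R \<subseteq> I"
    using ideal_eq_carrier_iff[of a] cgenideal_minimal[OF assms(1,3)] by simp
  with assms(1,2) show False by (metis additive_subgroup.a_subset ideal.axioms(1) subset_antisym)
qed

lemma (in noetherian_cring) presimplifiable_imp_ideal_powers_meet_zero:
  assumes "presimplifiable R"
  shows "ideal_powers_meet_zero R"
  unfolding ideal_powers_meet_zero_def
proof (intro allI impI, elim conjE)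
  fix I assume I: "ideal I R" "I \<noteq> carrier R"
  have "x = \<zero>" if x: "x \<in> (\<Inter>n\<in>{1..}. ideal_pow R I n)" for x
  proof -
    have "x \<in> ideal_pow R I 1" by (rule INT_D[OF x]) simp
    then have xc: "x \<in> carrier R" using ideal_pow_one[OF I(1)] ideal.Icarr[OF I(1)] by simp
    have "x \<in> ideal_pow R I n" for n
    proof (cases "n = 0")
      case False
      then have "n \<in> {1..}" by simp
      with x show ?thesis by (rule INT_D)
    qed (use xc in simp)
    then obtain i where i: "i \<in> I" "x = i \<otimes> x" using krull_intersection[OF I(1) xc] by metis
    then have ic: "i \<in> carrier R" using I(1) ideal.Icarr by metis
    then have "x = x \<otimes> i" using i xc m_comm by metis
    then show ?thesis
      using assms ic xc proper_ideal_no_units[OF I i(1)] unfolding presimplifiable_def by blast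
  qed
  then show "(\<Inter>n\<in>{1..}. ideal_pow R I n) = {\<zero>}"
    using ideal_zero[OF ideal_pow_ideal[OF I(1)]] by blast
qed

lemma (in cring) ideal_powers_meet_zero_imp_principal:
  assumes "ideal_powers_meet_zero R"
  shows "principal_powers_meet_zero R"
  unfolding principal_powers_meet_zero_def
proof
  fix y assume "y \<in> nonunits R"
  then have y: "y \<in> carrier R" "PIdl y \<noteq> carrier R"
    using ideal_eq_carrier_iff[of y] by (auto simp: nonunits_def)
  then have "(\<Inter>n\<in>{1..}. ideal_pow R (PIdl y) n) = {\<zero>}"
    using assms cgenideal_ideal unfolding ideal_powers_meet_zero_def by blast
  then show "(\<Inter>n\<in>{1::nat..}. PIdl (y [^] n)) = {\<zero>}"
    by (simp only: ideal_pow_principal[OF y(1)])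
qed

lemma (in cring) absorb_power:
  assumes "x \<in> carrier R" "y \<in> carrier R" and "x = x \<otimes> y"
  shows "x \<otimes> y [^] (n::nat) = x"
proof (induction n)
  case (Suc n)
  have "x \<otimes> y [^] Suc n = (x \<otimes> y [^] n) \<otimes> y" using assms(1,2) by (simp add: m_assoc)
  with Suc assms(3) show ?case by simp
qed (use assms in simp)

lemma (in cring) principal_powers_meet_zero_imp_presimplifiable:
  assumes "principal_powers_meet_zero R"
  shows "presimplifiable R"
  unfolding presimplifiable_def
proof (intro ballI impI)
  fix x y assume x: "x \<in> carrier R" and y: "y \<in> carrier R" and xy: "x = x \<otimes> y"
  have "x \<in> (\<Inter>n\<in>{1::nat..}. PIdl (y [^] n))"
    using absorb_power[OF x y xy] x unfolding cgenideal_def by (metis (mono_tags, lifting) INT_I mem_Collect_eq)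
  then show "x = \<zero> \<or> y \<in> Units R"
    using assms y unfolding principal_powers_meet_zero_def nonunits_def by blast
qed

lemma (in cring) foldr_replicate_append:
  assumes "a \<in> carrier R" "set as \<subseteq> carrier R"
  shows "foldr (\<otimes>) (replicate n a @ as) \<one> = a [^] n \<otimes> foldr (\<otimes>) as \<one>"
proof (induction n)
  case (Suc n)
  have "a \<otimes> (a [^] n \<otimes> foldr (\<otimes>) as \<one>) = a [^] Suc n \<otimes> foldr (\<otimes>) as \<one>"
    using assms by (simp add: m_assoc[symmetric] nat_pow_Suc2[symmetric] del: nat_pow_Suc)
  with Suc show ?case by simp
qed (use assms in simp)

lemma (in cring) nonunits_mult_r:
  assumes "a \<in> nonunits R" "r \<in> carrier R"
  shows "r \<otimes> a \<in> nonunits R" "a \<otimes> r \<in> nonunits R"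
proof -
  show "a \<otimes> r \<in> nonunits R" using assms unit_factor unfolding nonunits_def by blast
  then show "r \<otimes> a \<in> nonunits R" using assms m_comm unfolding nonunits_def by (metis DiffD1)
qed

lemma nonunits_subset_carrier: "nonunits R \<subseteq> carrier R"
  by (auto simp: nonunits_def)

lemma (in cring) BFR_imp_presimplifiable:
  assumes "BFR R"
  shows "presimplifiable R"
  unfolding presimplifiable_def
proof (intro ballI impI, rule ccontr)
  fix x y assume x: "x \<in> carrier R" and y: "y \<in> carrier R" and xy: "x = x \<otimes> y"
    and neg: "\<not> (x = \<zero> \<or> y \<in> Units R)"
  from neg y have y': "y \<in> nonunits R" by (simp add: nonunits_def)
  then have x': "x \<in> nonunits R" using nonunits_mult_r(1)[OF y' x] xy by simp
  with neg obtain N where N: "\<And>as. factorization R any_nonunit x as \<Longrightarrow> length as \<le> N"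
    using assms unfolding BFR_def by blast
  have "foldr (\<otimes>) (replicate N y @ [x]) \<one> = x"
    using absorb_power[OF x y xy] x y by (subst foldr_replicate_append) (auto simp: m_comm)
  then have "factorization R any_nonunit x (replicate N y @ [x])"
    using x' y' by (auto simp: factorization_def)
  from N[OF this] show False by simp
qed

lemma (in cring) foldr_mem_ideal_pow:
  assumes P: "ideal P R" and "set as \<subseteq> carrier R"
  shows "foldr (\<otimes>) as \<one> \<in> ideal_pow R P (length (filter (\<lambda>a. a \<in> P) as))"
  using assms(2)
proof (induction as)
  case (Cons a as)
  let ?p = "foldr (\<otimes>) as \<one>"
  have p: "?p \<in> ideal_pow R P (length (filter (\<lambda>a. a \<in> P) as))" "?p \<in> carrier R" "a \<in> carrier R"
    using Cons by auto
  show ?case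
  proof (cases "a \<in> P")
    case True
    with p(1) have "?p \<otimes> a \<in> ideal_pow R P (Suc (length (filter (\<lambda>a. a \<in> P) as)))"
      by (auto intro: ideal_prod.prod)
    with True p show ?thesis by (simp add: m_comm)
  next
    case False
    with p show ?thesis by (simp add: ideal.I_l_closed[OF ideal_pow_ideal[OF P]])
  qed
qed simp

lemma length_le_sum_filter_cover:
  assumes "finite \<F>" "set as \<subseteq> \<Union>\<F>"
  shows "length as \<le> (\<Sum>P\<in>\<F>. length (filter (\<lambda>a. a \<in> P) as))"
  using assms(2)
proof (induction as)
  case (Cons a as)
  then obtain P where "P \<in> \<F>" "a \<in> P" by auto
  then have "(\<Sum>P\<in>\<F>. length (filter (\<lambda>a. a \<in> P) as)) < (\<Sum>P\<in>\<F>. length (filter (\<lambda>a. a \<in> P) (a # as)))"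
    by (intro sum_strict_mono_ex1[OF assms(1)]) auto
  with Cons show ?case by simp
qed simp

text \<open>A nonunit factor \<open>a\<close> of \<open>x = a c \<noteq> 0\<close> is a zero divisor modulo \<open>(x)\<close>: if \<open>c = r x\<close>, then
\<open>x = x (a r)\<close> would make \<open>a r\<close>, and hence \<open>a\<close>, a unit. So all factors lie in the finitely many ideals \<open>P\<close> of a cover, and if \<open>x \<notin> P\<^sup>m\<close> with
\<open>m\<close> depending on \<open>P\<close>, then each \<open>P\<close> contains at most \<open>m\<close> of them, which bounds the length by the sum
of these exponents.\<close>

lemma (in noetherian_cring) presimplifiable_imp_BFR:
  assumes ps: "presimplifiable R"
  shows "BFR R"
  unfolding BFR_def
proof
  fix x assume x: "x \<in> nonunits R - {\<zero>}"
  then have xc: "x \<in> carrier R" by (simp add: nonunits_def)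
  obtain \<F> where fin: "finite \<F>" and proper: "\<And>P. P \<in> \<F> \<Longrightarrow> ideal P R \<and> P \<noteq> carrier R"
    and cover: "\<And>a c. a \<in> carrier R \<Longrightarrow> c \<in> carrier R \<Longrightarrow> c \<notin> PIdl x \<Longrightarrow> a \<otimes> c \<in> PIdl x \<Longrightarrow> a \<in> \<Union>\<F>"
  proof -
    obtain \<F> where *: "finite \<F> \<and> (\<forall>P\<in>\<F>. ideal P R \<and> P \<noteq> carrier R) \<and>
        (\<forall>a\<in>carrier R. \<forall>c\<in>carrier R - PIdl x. a \<otimes> c \<in> PIdl x \<longrightarrow> a \<in> \<Union>\<F>)"
      using zero_divisors_covered[OF cgenideal_ideal[OF xc]] ..
    show thesis by (rule that[of \<F>]) (use * in auto)
  qed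
  have "\<exists>m. x \<notin> ideal_pow R P m" if "P \<in> \<F>" for P
    using presimplifiable_imp_ideal_powers_meet_zero[OF ps] proper[OF that] x
    unfolding ideal_powers_meet_zero_def by blast
  then obtain m where m: "\<And>P. P \<in> \<F> \<Longrightarrow> x \<notin> ideal_pow R P (m P)" by metis
  have "length as \<le> (\<Sum>P\<in>\<F>. m P)" if fact: "factorization R any_nonunit x as" for as
  proof -
    have as: "set as \<subseteq> nonunits R" "foldr (\<otimes>) as \<one> = x" using fact unfolding factorization_def by blast+
    have asc: "set as \<subseteq> carrier R" using as(1) nonunits_subset_carrier by (rule subset_trans)
    have "a \<in> \<Union>\<F>" if a: "a \<in> set as" for a
    proof -
      have "a divides x" using multlist_dividesI[OF a asc] unfolding as(2) .
      then obtain c where c: "c \<in> carrier R" "x = a \<otimes> c" by (rule dividesE)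
      have "a \<in> nonunits R" using a as(1) by (rule rev_subsetD)
      then have an: "a \<in> carrier R" "a \<notin> Units R" unfolding nonunits_def by simp_all
      have "c \<notin> PIdl x"
      proof
        assume "c \<in> PIdl x"
        then obtain r where r: "r \<in> carrier R" "c = r \<otimes> x" unfolding cgenideal_def by blast
        have "a \<otimes> (r \<otimes> x) = x \<otimes> (a \<otimes> r)" using xc r(1) an(1) by algebra
        with c(2) r(2) have "x = x \<otimes> (a \<otimes> r)" by metis
        moreover have "a \<otimes> r \<in> carrier R" using an(1) r(1) by simp
        ultimately have "a \<otimes> r \<in> Units R"
          using ps x xc unfolding presimplifiable_def by (metis DiffD2 singletonI)
        then show False using unit_factor[OF _ an(1) r(1)] an(2) by blast
      qed
      moreover have "a \<otimes> c \<in> PIdl x" using cgenideal_self[OF xc] unfolding c(2)[symmetric] .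
      ultimately show ?thesis by (rule cover[OF an(1) c(1)])
    qed
    then have "length as \<le> (\<Sum>P\<in>\<F>. length (filter (\<lambda>a. a \<in> P) as))"
      by (intro length_le_sum_filter_cover[OF fin]) blast
    also have "\<dots> \<le> (\<Sum>P\<in>\<F>. m P)"
    proof (rule sum_mono, rule ccontr)
      fix P assume P: "P \<in> \<F>" and "\<not> length (filter (\<lambda>a. a \<in> P) as) \<le> m P"
      then have "ideal_pow R P (length (filter (\<lambda>a. a \<in> P) as)) \<subseteq> ideal_pow R P (m P)"
        using proper by (intro ideal_pow_antimono) auto
      moreover have "x \<in> ideal_pow R P (length (filter (\<lambda>a. a \<in> P) as))"
        using foldr_mem_ideal_pow[OF _ asc, of P] proper[OF P] unfolding as(2) by simp
      ultimately show False using m[OF P] by blast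
    qed
    finally show ?thesis .
  qed
  then show "\<exists>N. \<forall>as. factorization R any_nonunit x as \<longrightarrow> length as \<le> N" by blast
qed

section \<open>Principal ideals in place of associate classes\<close>

text \<open>What the argument uses about \<open>\<beta>\<close>: it refines equality of principal ideals, and does not differ from it
in a presimplifiable ring. The reflexive closure takes care of very strong associates, which are not
reflexive in general.\<close>

definition associate_relation :: "('a, 'b) ring_scheme \<Rightarrow> ('a \<Rightarrow> 'a \<Rightarrow> bool) \<Rightarrow> bool" where
  "associate_relation R \<beta> \<longleftrightarrow>
     (\<forall>a\<in>carrier R. \<forall>b\<in>carrier R. \<beta>\<^sup>=\<^sup>= a b \<longrightarrow> PIdl\<^bsub>R\<^esub> a = PIdl\<^bsub>R\<^esub> b) \<and>
     (presimplifiable R \<longrightarrow>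
       (\<forall>a\<in>carrier R. \<forall>b\<in>carrier R. PIdl\<^bsub>R\<^esub> a = PIdl\<^bsub>R\<^esub> b \<longrightarrow> \<beta> a b))"

lemma (in cring) cgenideal_unit_mult:
  assumes "u \<in> Units R" "b \<in> carrier R"
  shows "PIdl (u \<otimes> b) = PIdl b"
proof -
  have "u \<otimes> b \<sim> b" using assms by (intro associatedI2'[of _ _ u]) (auto simp: m_comm)
  then show ?thesis using assms associated_iff_same_ideal[of "u \<otimes> b" b] Units_closed by simp
qed

lemma (in cring) cgenideal_eqE:
  assumes "PIdl a = PIdl b" "a \<in> carrier R"
  obtains r where "r \<in> carrier R" "a = r \<otimes> b"
  using assms cgenideal_self[OF assms(2)] unfolding cgenideal_def by auto

text \<open>The reason why the associate relations coincide in a presimplifiable ring: \<open>a = r b\<close> and \<open>b = s a\<close> give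
\<open>a = a (r s)\<close>.\<close>

lemma (in cring) presimplifiable_associates_unit:
  assumes ps: "presimplifiable R" and eq: "PIdl a = PIdl b"
    and a: "a \<in> carrier R" and b: "b \<in> carrier R" and r: "r \<in> carrier R" and "a = r \<otimes> b" "a \<noteq> \<zero>"
  shows "r \<in> Units R"
proof -
  obtain s where s: "s \<in> carrier R" "b = s \<otimes> a" using eq b by (metis cgenideal_eqE)
  have "a = r \<otimes> (s \<otimes> a)" using assms(6) s(2) by simp
  also have "\<dots> = a \<otimes> (r \<otimes> s)" using a r s by algebra
  finally have "r \<otimes> s \<in> Units R" using ps a r s(1) assms(7) unfolding presimplifiable_def by blast
  then show ?thesis using r s unit_factor by blast
qed

lemma (in cring) cgenideal_zero_iff:
  assumes "a \<in> carrier R" "PIdl a = PIdl \<zero>"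
  shows "a = \<zero>"
  using assms by (metis cgenideal_eqE r_null)

lemma (in cring) associate_relations:
  assumes "\<beta> \<in> {associates R, strong_associates R, very_strong_associates R}"
  shows "associate_relation R \<beta>"
proof -
  have strong: "strong_associates R a b" and very_strong: "very_strong_associates R a b"
    if "presimplifiable R" "a \<in> carrier R" "b \<in> carrier R" "PIdl a = PIdl b" for a b
  proof -
    have *: "r \<in> Units R" if "r \<in> carrier R" "a = r \<otimes> b" "a \<noteq> \<zero>" for r
      using presimplifiable_associates_unit that \<open>presimplifiable R\<close> \<open>a \<in> _\<close> \<open>b \<in> _\<close> \<open>PIdl a = PIdl b\<close>
      by blast
    have b0: "b = \<zero>" if "a = \<zero>" using that \<open>PIdl a = PIdl b\<close> \<open>b \<in> _\<close> cgenideal_zero_iff by metis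
    obtain r where r: "r \<in> carrier R" "a = r \<otimes> b"
      using \<open>PIdl a = PIdl b\<close> \<open>a \<in> _\<close> by (rule cgenideal_eqE)
    show "strong_associates R a b"
    proof (cases "a = \<zero>")
      case True
      then show ?thesis using b0 unfolding strong_associates_def by (intro bexI[of _ "\<one>"]) auto
    next
      case False
      then show ?thesis using * r unfolding strong_associates_def by blast
    qed
    show "very_strong_associates R a b"
      using * b0 \<open>PIdl a = PIdl b\<close> unfolding very_strong_associates_def associates_def by blast
  qed
  show ?thesis
    using assms strong very_strong cgenideal_unit_mult unfolding associate_relation_def
    by (auto simp: associates_def strong_associates_def very_strong_associates_def)
qed

text \<open>This and the following lemma replace finiteness up to a relation by finiteness of the image under an
invariant of the relation, here principal ideals, lists of them, or lengths of factorizations.\<close>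

lemma finite_up_to_imp_finite_image:
  assumes "finite_up_to \<beta> A" and "\<And>a b. a \<in> A \<Longrightarrow> b \<in> A \<Longrightarrow> \<beta>\<^sup>=\<^sup>= a b \<Longrightarrow> f a = f b"
  shows "finite (f ` A)"
proof -
  obtain F where F: "F \<subseteq> A" "finite F" "\<forall>a\<in>A. \<exists>b\<in>F. \<beta>\<^sup>=\<^sup>= a b"
    using assms(1) unfolding finite_up_to_def by blast
  then have "f ` A \<subseteq> f ` F" using assms(2) by blast
  with F(2) show ?thesis by (blast intro: finite_subset)
qed

lemma finite_image_imp_finite_up_to:
  assumes "finite (f ` A)" and "\<And>a b. a \<in> A \<Longrightarrow> b \<in> A \<Longrightarrow> f a = f b \<Longrightarrow> \<beta>\<^sup>=\<^sup>= a b"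
  shows "finite_up_to \<beta> A"
  unfolding finite_up_to_def
proof (intro exI conjI ballI)
  show "inv_into A f ` f ` A \<subseteq> A" by (auto intro: inv_into_into)
  fix a assume "a \<in> A"
  then show "\<exists>b\<in>inv_into A f ` f ` A. \<beta>\<^sup>=\<^sup>= a b"
    using assms(2)[of a "inv_into A f (f a)"] by (auto simp: f_inv_into_f inv_into_into)
qed (use assms(1) in auto)

lemma (in cring) finite_up_to_iff_finite_ideals:
  assumes \<beta>: "associate_relation R \<beta>" and ps: "presimplifiable R" and A: "A \<subseteq> carrier R"
  shows "finite_up_to \<beta> A \<longleftrightarrow> finite ((\<lambda>a. PIdl a) ` A)"
proof
  assume "finite_up_to \<beta> A"
  then show "finite ((\<lambda>a. PIdl a) ` A)"
    by (rule finite_up_to_imp_finite_image) (use \<beta> A in \<open>unfold associate_relation_def, blast\<close>)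
next
  assume "finite ((\<lambda>a. PIdl a) ` A)"
  then show "finite_up_to \<beta> A"
    by (rule finite_image_imp_finite_up_to) (use \<beta> ps A in \<open>unfold associate_relation_def, blast\<close>)
qed

definition divisor_ideals :: "('a, 'b) ring_scheme \<Rightarrow> ('a \<Rightarrow> bool) \<Rightarrow> 'a \<Rightarrow> 'a set set" where
  "divisor_ideals R \<gamma> x = (\<lambda>a. PIdl\<^bsub>R\<^esub> a) ` {a \<in> graph_elements R \<gamma>. a divides\<^bsub>R\<^esub> x}"

lemma (in cring) representative_of_ideal:
  assumes "associate_relation R \<beta>" and S: "is_representatives \<beta> (graph_elements R \<gamma>) S"
    and a: "a \<in> graph_elements R \<gamma>"
  obtains s where "s \<in> S" "s \<in> graph_elements R \<gamma>" "PIdl a = PIdl s"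
proof -
  obtain s where s: "s \<in> S" "\<beta>\<^sup>=\<^sup>= a s" using S a unfolding is_representatives_def by blast
  moreover have s': "s \<in> graph_elements R \<gamma>" using S s(1) unfolding is_representatives_def by blast
  moreover have "PIdl a = PIdl s"
    using assms(1) a s' s(2) unfolding associate_relation_def graph_elements_def nonunits_def by blast
  ultimately show thesis by (intro that)
qed

lemma (in cring) vertex_ideals:
  assumes \<beta>: "associate_relation R \<beta>" and S: "is_representatives \<beta> (graph_elements R \<gamma>) S"
    and x: "x \<in> carrier R"
  shows "(\<lambda>a. PIdl a) ` vertices R S x = divisor_ideals R \<gamma> x"
proof
  have "S \<subseteq> graph_elements R \<gamma>" using S unfolding is_representatives_def by blast
  then show "(\<lambda>a. PIdl a) ` vertices R S x \<subseteq> divisor_ideals R \<gamma> x"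
    by (auto simp: vertices_def divisor_ideals_def)
  have "PIdl a \<in> (\<lambda>a. PIdl a) ` vertices R S x" if a: "a \<in> graph_elements R \<gamma>" "a divides x" for a
  proof -
    obtain s where s: "s \<in> S" "s \<in> graph_elements R \<gamma>" "PIdl a = PIdl s"
      using \<beta> S a(1) by (rule representative_of_ideal)
    have "a \<in> carrier R" "s \<in> carrier R" using a s by (auto simp: graph_elements_def nonunits_def)
    then have "s divides x" using a(2) s(3) x to_contain_is_to_divide by metis
    then show ?thesis using s by (auto simp: vertices_def)
  qed
  then show "divisor_ideals R \<gamma> x \<subseteq> (\<lambda>a. PIdl a) ` vertices R S x"
    unfolding divisor_ideals_def by blast
qed

text \<open>Distinct representatives are not related by \<open>\<beta>\<close>, hence generate distinct ideals when \<open>\<beta>\<close> is as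
coarse as equality of principal ideals.\<close>

lemma (in cring) inj_on_representatives:
  assumes \<beta>: "associate_relation R \<beta>" and ps: "presimplifiable R"
    and S: "is_representatives \<beta> (graph_elements R \<gamma>) S"
  shows "inj_on (\<lambda>a. PIdl a) S"
proof (rule inj_onI)
  fix s t assume st: "s \<in> S" "t \<in> S" and eq: "PIdl s = PIdl t"
  have carr: "graph_elements R \<gamma> \<subseteq> carrier R" "S \<subseteq> graph_elements R \<gamma>"
    using S by (auto simp: graph_elements_def nonunits_def is_representatives_def)
  have "\<beta>\<^sup>=\<^sup>= s t" using \<beta> ps st carr eq unfolding associate_relation_def by blast
  moreover have "\<beta>\<^sup>=\<^sup>= s s" by simp
  moreover have "\<exists>!s'. s' \<in> S \<and> \<beta>\<^sup>=\<^sup>= s s'"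
    using S st carr unfolding is_representatives_def by blast
  ultimately show "s = t" using st by blast
qed

section \<open>Factorizations and divisors\<close>

text \<open>Elements that are not a product of two nonunits are the irreducible elements in the strongest sense;
if \<open>\<gamma>\<close> holds for them, then every factorization of maximal length of a nonzero nonunit is a
\<open>\<gamma>\<close>-factorization. The predicate covers ordinary factorizations and, in a presimplifiable ring, all
four notions of irreducibility.\<close>

definition contains_atoms :: "('a, 'b) ring_scheme \<Rightarrow> ('a \<Rightarrow> bool) \<Rightarrow> bool" where
  "contains_atoms R \<gamma> \<longleftrightarrow>
     (\<forall>a\<in>nonunits R - {\<zero>\<^bsub>R\<^esub>}.
        (\<forall>b\<in>nonunits R. \<forall>c\<in>nonunits R. a \<noteq> b \<otimes>\<^bsub>R\<^esub> c) \<longrightarrow> \<gamma> a)"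

text \<open>If \<open>a = b c\<close> has no splitting into nonunits, one of \<open>b\<close> and \<open>c\<close> is a unit, so \<open>a\<close> generates the same
ideal as the other; presimplifiability upgrades this to strong and very strong associates.\<close>

lemma (in cring) irreducible_notions_contain_atoms:
  assumes ps: "presimplifiable R"
    and \<alpha>: "\<alpha> \<in> {atomic R, strongly_atomic R, m_atomic R, very_strongly_atomic R}"
  shows "contains_atoms R \<alpha>"
  unfolding contains_atoms_def
proof (intro ballI impI)
  fix a assume a: "a \<in> nonunits R - {\<zero>}"
    and indec: "\<forall>b\<in>nonunits R. \<forall>c\<in>nonunits R. a \<noteq> b \<otimes> c"
  have ac: "a \<in> carrier R" using a by (simp add: nonunits_def)
  have split: "PIdl a = PIdl b \<or> PIdl a = PIdl c" if "b \<in> carrier R" "c \<in> carrier R" "a = b \<otimes> c" for b c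
  proof -
    have "b \<in> Units R \<or> c \<in> Units R" using indec that by (auto simp: nonunits_def)
    then show ?thesis using that cgenideal_unit_mult m_comm by metis
  qed
  have rel: "\<beta> a b \<or> \<beta> a c"
    if "\<beta> \<in> {associates R, strong_associates R, very_strong_associates R}"
      "b \<in> carrier R" "c \<in> carrier R" "a = b \<otimes> c" for \<beta> b c
    using associate_relations[OF that(1)] ps split[OF that(2-4)] ac that(2,3)
    unfolding associate_relation_def by metis
  have "m_atomic R a"
    unfolding m_atomic_def
  proof (intro conjI ballI impI; (elim conjE)?)
    fix b assume b: "b \<in> carrier R" and proper: "PIdl b \<noteq> carrier R" and sub: "PIdl a \<subseteq> PIdl b"
    then obtain c where c: "c \<in> carrier R" "a = b \<otimes> c"
      using to_contain_is_to_divide[OF b ac] unfolding factor_def by blast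
    have "b \<in> nonunits R" using b proper ideal_eq_carrier_iff[OF b] by (auto simp: nonunits_def)
    then have "c \<in> Units R" using indec c by (auto simp: nonunits_def)
    then show "PIdl a = PIdl b" using c b cgenideal_unit_mult m_comm by metis
  qed (use a in simp)
  moreover have "atomic R a" "strongly_atomic R a" "very_strongly_atomic R a"
    unfolding atomic_def strongly_atomic_def very_strongly_atomic_def using rel a by blast+
  ultimately show "\<alpha> a" using \<alpha> by blast
qed

lemma (in cring) factorization_carrier:
  assumes "factorization R \<gamma> x as"
  shows "set as \<subseteq> carrier R"
  using assms nonunits_subset_carrier[of R] by (auto simp: factorization_def)

text \<open>The cofactor \<open>e\<close> may be a unit or not; absorbing it into the first factor treats both cases alike. Hence
a factorization of a divisor of \<open>x\<close> is never longer than the longest factorizations of \<open>x\<close>.\<close>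

lemma (in cring) factorization_mult:
  assumes "factorization R \<gamma> d as" and e: "e \<in> carrier R"
  obtains bs where "factorization R any_nonunit (e \<otimes> d) bs" "length bs = length as"
proof -
  have carr: "set as \<subseteq> carrier R" using assms(1) by (rule factorization_carrier)
  obtain a as' where as: "as = a # as'"
    using assms(1) by (cases as) (auto simp: factorization_def)
  have "a \<in> nonunits R" using assms(1) as by (auto simp: factorization_def)
  then have "e \<otimes> a \<in> nonunits R" by (rule nonunits_mult_r) (rule e)
  moreover have "(e \<otimes> a) \<otimes> foldr (\<otimes>) as' \<one> = e \<otimes> (a \<otimes> foldr (\<otimes>) as' \<one>)"
    using carr e as by (intro m_assoc) auto
  ultimately have "factorization R any_nonunit (e \<otimes> d) ((e \<otimes> a) # as')"
    using assms(1) as unfolding factorization_def by auto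
  with that as show thesis by simp
qed

text \<open>In a factorization of maximal length no factor is a product of two nonunits, since splitting it would
give a longer factorization.\<close>

lemma (in cring) BFR_factorization_exists:
  assumes "BFR R" and atoms: "contains_atoms R \<gamma>" and x: "x \<in> nonunits R - {\<zero>}"
  obtains as where "factorization R \<gamma> x as"
proof -
  let ?fact = "factorization R any_nonunit x"
  obtain N where N: "\<And>as. ?fact as \<Longrightarrow> length as \<le> N" using assms(1) x unfolding BFR_def by blast
  have "?fact [x]" using x by (simp add: factorization_def nonunits_def)
  then have "\<exists>as. ?fact as \<and> (\<forall>bs. ?fact bs \<longrightarrow> length bs \<le> length as)"
    by (rule Lattices_Big.ex_has_greatest_nat[where f = length and b = "Suc N"]) (use N in \<open>simp add: less_Suc_eq_le\<close>)
  then obtain as where as: "?fact as" and max: "\<And>bs. ?fact bs \<Longrightarrow> length bs \<le> length as"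
    by blast
  have carr: "set as \<subseteq> carrier R" using as by (rule factorization_carrier)
  have "\<gamma> a" if a: "a \<in> set as" for a
  proof -
    have "a \<in> nonunits R" using a as by (auto simp: factorization_def)
    moreover have "a \<noteq> \<zero>"
    proof
      assume "a = \<zero>"
      then have "\<zero> divides x" using multlist_dividesI[OF a carr] as by (simp add: factorization_def)
      then show False using x by (auto elim!: dividesE)
    qed
    moreover have "a \<noteq> b \<otimes> c" if b: "b \<in> nonunits R" and c: "c \<in> nonunits R" for b c
    proof
      assume a_eq: "a = b \<otimes> c"
      obtain us vs where uvs: "as = us @ a # vs" using split_list[OF a] by blast
      have bc: "b \<in> carrier R" "c \<in> carrier R" using b c by (auto simp: nonunits_def)
      have uvc: "set us \<subseteq> carrier R" "set vs \<subseteq> carrier R" using carr uvs by auto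
      have "foldr (\<otimes>) (us @ b # c # vs) \<one> = foldr (\<otimes>) as \<one>"
        unfolding uvs a_eq using bc uvc by (simp add: m_assoc)
      then have "?fact (us @ b # c # vs)"
        using as b c unfolding factorization_def uvs by auto
      from max[OF this] show False by (simp add: uvs)
    qed
    ultimately show ?thesis using atoms unfolding contains_atoms_def by blast
  qed
  with as have "factorization R \<gamma> x as" by (simp add: factorization_def)
  with that show thesis .
qed

lemma (in cring) divisor_ideals_any_nonunit:
  assumes "x \<in> carrier R"
  shows "(\<lambda>a. PIdl a) ` {d \<in> carrier R. d divides x} = insert (carrier R) (divisor_ideals R any_nonunit x)"
proof -
  have "{d \<in> carrier R. d divides x} = Units R \<union> {a \<in> nonunits R. a divides x}"
    using unit_divides assms by (auto simp: nonunits_def)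
  moreover have "(\<lambda>a. PIdl a) ` Units R = {carrier R}"
    using ideal_eq_carrier_iff by (auto simp: Units_closed intro!: image_eqI[of _ _ \<one>])
  ultimately show ?thesis by (simp add: divisor_ideals_def graph_elements_def image_Un)
qed

lemma (in cring) cgenideal_foldr:
  assumes "set as \<subseteq> carrier R"
  shows "PIdl (foldr (\<otimes>) as \<one>) = foldr (\<cdot>) (map (\<lambda>a. PIdl a) as) (carrier R)"
  using assms by (induction as) (simp_all add: cgenideal_one ideal_prod_principal[symmetric])

text \<open>A nonunit divisor \<open>d\<close> of \<open>x\<close> has a \<open>\<gamma>\<close>-factorization, its factors divide \<open>x\<close>, and their number is at most
the length bound of \<open>x\<close>. Therefore \<open>(d)\<close> is a product of boundedly many ideals from the finite set
\<open>divisor_ideals R \<gamma> x\<close>.\<close>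

lemma (in cring) finite_divisor_ideals_if_atoms:
  assumes "BFR R" and atoms: "contains_atoms R \<gamma>" and x: "x \<in> nonunits R - {\<zero>}"
    and fin: "finite (divisor_ideals R \<gamma> x)"
  shows "finite (divisor_ideals R any_nonunit x)"
proof -
  obtain N where N: "\<And>as. factorization R any_nonunit x as \<Longrightarrow> length as \<le> N"
    using assms(1) x unfolding BFR_def by blast
  let ?L = "{Is. set Is \<subseteq> divisor_ideals R \<gamma> x \<and> length Is \<le> N}"
  have "PIdl d \<in> (\<lambda>Is. foldr (\<cdot>) Is (carrier R)) ` ?L" if d: "d \<in> nonunits R" "d divides x" for d
  proof -
    obtain e where e: "e \<in> carrier R" "x = d \<otimes> e" using d(2) by (rule dividesE)
    have "d \<noteq> \<zero>" using e x by auto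
    then obtain as where as: "factorization R \<gamma> d as"
      using BFR_factorization_exists[OF assms(1) atoms, of d] d(1) by blast
    have carr: "set as \<subseteq> carrier R" using as by (rule factorization_carrier)
    have dc: "d \<in> carrier R" using d by (simp add: nonunits_def)
    have x_eq: "x = e \<otimes> d" using e dc m_comm by simp
    obtain bs where "factorization R any_nonunit x bs" "length bs = length as"
      using factorization_mult[OF as e(1)] unfolding x_eq .
    with N have len: "length as \<le> N" by metis
    have "PIdl a \<in> divisor_ideals R \<gamma> x" if a: "a \<in> set as" for a
    proof -
      have "a divides d" using multlist_dividesI[OF a carr] as by (simp add: factorization_def)
      moreover have "a \<in> carrier R" using a carr by (rule rev_subsetD)
      ultimately have "a divides x" using divides_trans[OF _ d(2)] by simp
      then show ?thesis
        using a as by (auto simp: divisor_ideals_def graph_elements_def factorization_def)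
    qed
    moreover have "PIdl d = foldr (\<cdot>) (map (\<lambda>a. PIdl a) as) (carrier R)"
      using cgenideal_foldr[OF carr] as by (simp add: factorization_def)
    ultimately show ?thesis using len by (intro image_eqI[of _ _ "map (\<lambda>a. PIdl a) as"]) auto
  qed
  then have "divisor_ideals R any_nonunit x \<subseteq> (\<lambda>Is. foldr (\<cdot>) Is (carrier R)) ` ?L"
    by (auto simp: divisor_ideals_def graph_elements_def)
  then show ?thesis by (rule finite_subset) (intro finite_imageI finite_lists_length_le fin)
qed

lemma (in cring) finite_divisor_ideals_iff_atoms:
  assumes "BFR R" and "contains_atoms R \<gamma>" and "x \<in> nonunits R - {\<zero>}"
  shows "finite (divisor_ideals R \<gamma> x) \<longleftrightarrow> finite (divisor_ideals R any_nonunit x)"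
proof
  have "divisor_ideals R \<gamma> x \<subseteq> divisor_ideals R any_nonunit x"
    by (auto simp: divisor_ideals_def graph_elements_def)
  then show "finite (divisor_ideals R \<gamma> x)" if "finite (divisor_ideals R any_nonunit x)"
    using that by (rule finite_subset)
qed (rule finite_divisor_ideals_if_atoms[OF assms])

section \<open>Finite factorization rings\<close>

lemma FFR_imp_BFR:
  assumes "FFR R \<beta>"
  shows "BFR R"
  unfolding BFR_def
proof
  fix x assume "x \<in> nonunits R - {\<zero>\<^bsub>R\<^esub>}"
  then have "finite_up_to (same_up_to \<beta>) {as. factorization R any_nonunit x as}"
    using assms unfolding FFR_def by blast
  then have "finite (length ` {as. factorization R any_nonunit x as})"
  proof (rule finite_up_to_imp_finite_image)
    fix as bs :: "'a list" assume "(same_up_to \<beta>)\<^sup>=\<^sup>= as bs"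
    then consider "as = bs" | cs where "mset cs = mset as" "list_all2 \<beta>\<^sup>=\<^sup>= cs bs"
      unfolding same_up_to_def by auto
    then show "length as = length bs"
      by cases (simp, metis list_all2_lengthD mset_eq_length)
  qed
  then obtain N where "\<forall>n\<in>length ` {as. factorization R any_nonunit x as}. n \<le> N"
    unfolding finite_nat_set_iff_bounded_le by blast
  then show "\<exists>N. \<forall>as. factorization R any_nonunit x as \<longrightarrow> length as \<le> N" by blast
qed

text \<open>A divisor \<open>d\<close> of \<open>x = d e\<close> generates \<open>(x)\<close> if \<open>e\<close> is a unit, and otherwise occurs in the factorization
\<open>[d, e]\<close>, hence up to \<open>\<beta>\<close> in one of finitely many factorizations.\<close>

lemma (in cring) FFR_imp_finite_divisor_ideals:
  assumes \<beta>: "associate_relation R \<beta>" and "FFR R \<beta>" and x: "x \<in> nonunits R - {\<zero>}"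
  shows "finite (divisor_ideals R any_nonunit x)"
proof -
  let ?fact = "factorization R any_nonunit x"
  have "finite_up_to (same_up_to \<beta>) {as. ?fact as}"
    using assms(2) x unfolding FFR_def by blast
  then obtain F where F: "F \<subseteq> {as. ?fact as}" "finite F"
    and "\<forall>as\<in>{as. ?fact as}. \<exists>bs\<in>F. (same_up_to \<beta>)\<^sup>=\<^sup>= as bs"
    unfolding finite_up_to_def by (elim exE conjE)
  then have rep: "\<And>as. ?fact as \<Longrightarrow> \<exists>bs\<in>F. (same_up_to \<beta>)\<^sup>=\<^sup>= as bs"
    by (metis mem_Collect_eq)
  have xc: "x \<in> carrier R" using x by (simp add: nonunits_def)
  have "PIdl d \<in> insert (PIdl x) (\<Union>bs\<in>F. (\<lambda>b. PIdl b) ` set bs)"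
    if d: "d \<in> nonunits R" "d divides x" for d
  proof -
    obtain e where e: "e \<in> carrier R" "x = d \<otimes> e" using d(2) by (rule dividesE)
    have dc: "d \<in> carrier R" using d by (simp add: nonunits_def)
    show ?thesis
    proof (cases "e \<in> Units R")
      case True
      then have "PIdl x = PIdl d" using e dc cgenideal_unit_mult m_comm by metis
      then show ?thesis by simp
    next
      case False
      then have "?fact [d, e]" using d e dc by (simp add: factorization_def nonunits_def)
      then obtain bs where bs: "bs \<in> F" "(same_up_to \<beta>)\<^sup>=\<^sup>= [d, e] bs" using rep by blast
      have "\<exists>b\<in>set bs. \<beta>\<^sup>=\<^sup>= d b"
      proof (cases "[d, e] = bs")
        case False
        then obtain cs where cs: "mset cs = mset [d, e]" "list_all2 \<beta>\<^sup>=\<^sup>= cs bs"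
          using bs(2) unfolding same_up_to_def by auto
        then have "d \<in> set cs" by (metis list.set_intros(1) set_mset_mset)
        with cs(2) show ?thesis by (metis list_all2_conv_all_nth in_set_conv_nth)
      qed auto
      then obtain b where b: "b \<in> set bs" "\<beta>\<^sup>=\<^sup>= d b" by blast
      have "b \<in> carrier R" using b(1) bs(1) F(1) factorization_carrier by blast
      then have "PIdl d = PIdl b" using \<beta> dc b(2) unfolding associate_relation_def by blast
      with b bs show ?thesis by blast
    qed
  qed
  then have "divisor_ideals R any_nonunit x \<subseteq> insert (PIdl x) (\<Union>bs\<in>F. (\<lambda>b. PIdl b) ` set bs)"
    by (auto simp: divisor_ideals_def graph_elements_def)
  then show ?thesis by (rule finite_subset) (use F(2) in simp)
qed

text \<open>A factorization is determined up to \<open>\<beta>\<close> by the list of principal ideals generated by its factors, and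
these lists have bounded length and entries in a finite set.\<close>

lemma (in cring) finite_divisor_ideals_imp_FFR:
  assumes \<beta>: "associate_relation R \<beta>" and "BFR R"
    and fin: "\<And>x. x \<in> nonunits R - {\<zero>} \<Longrightarrow> finite (divisor_ideals R any_nonunit x)"
  shows "FFR R \<beta>"
  unfolding FFR_def
proof
  fix x assume x: "x \<in> nonunits R - {\<zero>}"
  let ?fact = "factorization R any_nonunit x"
  have ps: "presimplifiable R" using assms(2) by (rule BFR_imp_presimplifiable)
  obtain N where N: "\<And>as. ?fact as \<Longrightarrow> length as \<le> N" using assms(2) x unfolding BFR_def by blast
  have "map (\<lambda>a. PIdl a) ` {as. ?fact as} \<subseteq> {Is. set Is \<subseteq> divisor_ideals R any_nonunit x \<and> length Is \<le> N}"
  proof (intro subsetI, elim imageE, simp, intro conjI)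
    fix as assume as: "?fact as"
    then show "length as \<le> N" by (rule N)
    have "a divides x" if "a \<in> set as" for a
      using multlist_dividesI[OF that factorization_carrier[OF as]] as by (simp add: factorization_def)
    then show "(\<lambda>a. PIdl a) ` set as \<subseteq> divisor_ideals R any_nonunit x"
      using as by (auto simp: divisor_ideals_def graph_elements_def factorization_def)
  qed
  then have "finite (map (\<lambda>a. PIdl a) ` {as. ?fact as})"
    by (rule finite_subset) (rule finite_lists_length_le[OF fin[OF x]])
  then show "finite_up_to (same_up_to \<beta>) {as. ?fact as}"
  proof (rule finite_image_imp_finite_up_to)
    fix as bs assume as: "as \<in> {as. ?fact as}" and bs: "bs \<in> {as. ?fact as}"
      and eq: "map (\<lambda>a. PIdl a) as = map (\<lambda>a. PIdl a) bs"
    have carr: "set as \<subseteq> carrier R" "set bs \<subseteq> carrier R" using as bs factorization_carrier by blast+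
    have "list_all2 \<beta>\<^sup>=\<^sup>= as bs"
    proof (rule list_all2_all_nthI)
      show len: "length as = length bs" using eq by (rule map_eq_imp_length_eq)
      fix n assume n: "n < length as"
      then have "PIdl (as ! n) = PIdl (bs ! n)" using eq len by (metis nth_map)
      moreover have "as ! n \<in> carrier R" "bs ! n \<in> carrier R" using n len carr by auto
      ultimately show "\<beta>\<^sup>=\<^sup>= (as ! n) (bs ! n)" using \<beta> ps unfolding associate_relation_def by blast
    qed
    then show "(same_up_to \<beta>)\<^sup>=\<^sup>= as bs" unfolding same_up_to_def by auto
  qed
qed

lemma (in cring) FFR_iff_finite_divisor_ideals:
  assumes "associate_relation R \<beta>"
  shows "FFR R \<beta> \<longleftrightarrow> BFR R \<and> (\<forall>x\<in>nonunits R - {\<zero>}. finite (divisor_ideals R any_nonunit x))"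
proof (intro iffI conjI ballI)
  assume FFR: "FFR R \<beta>"
  show "BFR R" using FFR by (rule FFR_imp_BFR)
  show "finite (divisor_ideals R any_nonunit x)" if "x \<in> nonunits R - {\<zero>}" for x
    using assms FFR that by (rule FFR_imp_finite_divisor_ideals)
next
  assume "BFR R \<and> (\<forall>x\<in>nonunits R - {\<zero>}. finite (divisor_ideals R any_nonunit x))"
  then show "FFR R \<beta>" by (intro finite_divisor_ideals_imp_FFR[OF assms]) simp_all
qed

lemma (in cring) WFFR_iff_finite_divisor_ideals:
  assumes "associate_relation R \<beta>" and "presimplifiable R"
  shows "WFFR R \<beta> \<longleftrightarrow> (\<forall>x\<in>nonunits R - {\<zero>}. finite (divisor_ideals R any_nonunit x))"
proof -
  have "finite_up_to \<beta> {d \<in> carrier R. d divides x} \<longleftrightarrow> finite (divisor_ideals R any_nonunit x)"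
    if "x \<in> nonunits R" for x
    using that finite_up_to_iff_finite_ideals[OF assms, of "{d \<in> carrier R. d divides x}"]
      divisor_ideals_any_nonunit[of x] by (auto simp: nonunits_def)
  then show ?thesis unfolding WFFR_def by auto
qed

lemma (in cring) divisor_finite_iff_finite_divisor_ideals:
  assumes "associate_relation R \<beta>" and "presimplifiable R" and "\<And>a. \<alpha> a \<Longrightarrow> a \<in> nonunits R"
  shows "divisor_finite R \<alpha> \<beta> \<longleftrightarrow> (\<forall>x\<in>nonunits R - {\<zero>}. finite (divisor_ideals R \<alpha> x))"
proof -
  have "{d \<in> carrier R. \<alpha> d \<and> d divides x} = {a \<in> graph_elements R \<alpha>. a divides x}" for x
    using assms(3) by (auto simp: graph_elements_def nonunits_def)
  moreover have "{a \<in> graph_elements R \<alpha>. a divides x} \<subseteq> carrier R" for x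
    by (auto simp: graph_elements_def nonunits_def)
  ultimately show ?thesis
    using finite_up_to_iff_finite_ideals[OF assms(1,2)]
    unfolding divisor_finite_def divisor_ideals_def by simp
qed

lemma (in cring) finite_vertices_iff_finite_divisor_ideals:
  assumes "associate_relation R \<beta>" and "presimplifiable R"
    and "is_representatives \<beta> (graph_elements R \<gamma>) S"
  shows "finite_vertices R S \<longleftrightarrow> (\<forall>x\<in>nonunits R - {\<zero>}. finite (divisor_ideals R \<gamma> x))"
proof -
  have "finite (vertices R S x) \<longleftrightarrow> finite (divisor_ideals R \<gamma> x)" if "x \<in> carrier R" for x
  proof -
    have "inj_on (\<lambda>a. PIdl a) (vertices R S x)"
      using inj_on_representatives[OF assms] by (rule inj_on_subset) (simp add: vertices_def)
    then show ?thesis using vertex_ideals[OF assms(1,3) that] finite_image_iff by metis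
  qed
  then show ?thesis unfolding finite_vertices_def by (simp add: nonunits_def)
qed

section \<open>Divisor graphs\<close>

text \<open>From \<open>x = x y\<^sup>n\<close> all powers of \<open>y\<close> divide \<open>x\<close>, hence so do all powers of a representative \<open>a\<close> of \<open>y\<close>,
because \<open>y\<close> is a multiple of \<open>a\<close>.\<close>

lemma (in cring) absorbed_nonunit_gives_infinite_loops:
  assumes \<beta>: "associate_relation R \<beta>"
    and S: "is_representatives \<beta> (graph_elements R any_nonunit) S"
    and x: "x \<in> carrier R" and y: "y \<in> nonunits R" and xy: "x = x \<otimes> y"
  obtains a where "a \<in> vertices R S x" "num_loops R any_nonunit x a = \<infinity>"
proof -
  have yc: "y \<in> carrier R" using y by (simp add: nonunits_def)
  have "y \<in> graph_elements R any_nonunit" using y by (simp add: graph_elements_def)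
  with \<beta> S obtain a where a: "a \<in> S" "a \<in> graph_elements R any_nonunit" "PIdl y = PIdl a"
    by (rule representative_of_ideal)
  have ac: "a \<in> carrier R" using a(2) by (simp add: graph_elements_def nonunits_def)
  obtain r where r: "r \<in> carrier R" "y = r \<otimes> a" using a(3) yc by (rule cgenideal_eqE)
  have pow: "a [^] n divides x" for n :: nat
  proof -
    have "a [^] n \<otimes> (x \<otimes> r [^] n) = x \<otimes> (r \<otimes> a) [^] n"
      using x r(1) ac by (simp add: nat_pow_distrib m_ac)
    also have "\<dots> = x" using absorb_power[OF x yc xy] unfolding r(2) .
    finally have "x = a [^] n \<otimes> (x \<otimes> r [^] n)" by (rule sym)
    then show ?thesis by (rule dividesI[rotated]) (use x r(1) in simp)
  qed
  have "a \<in> vertices R S x" using a(1) pow[of 1] ac by (simp add: vertices_def)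
  moreover have "num_loops R any_nonunit x a = \<infinity>" using pow by (auto simp: num_loops_def)
  ultimately show thesis by (rule that)
qed

text \<open>The other end of the edge is the representative \<open>b\<close> of the cofactor \<open>e\<close> in \<open>x = a e\<close>, which is a nonunit
as \<open>a\<close> does not generate \<open>(x)\<close>. Writing \<open>e = r b\<close>, the multiplier \<open>r\<close> is either a further factor or a
unit; the latter is where factorizations have to be read up to a unit. For \<open>a = b\<close> the edge is a
loop.\<close>

lemma (in cring) vertex_has_incident_edge:
  assumes \<beta>: "associate_relation R \<beta>"
    and S: "is_representatives \<beta> (graph_elements R any_nonunit) S"
    and x: "x \<in> carrier R" and a: "a \<in> vertices R S x" and ne: "PIdl a \<noteq> PIdl x"
  shows "(\<exists>b\<in>vertices R S x. adjacent R any_nonunit x a b) \<or> num_loops R any_nonunit x a \<noteq> 0"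
proof -
  have an: "a \<in> nonunits R"
    using a S by (auto simp: vertices_def is_representatives_def graph_elements_def)
  then have ac: "a \<in> carrier R" by (simp add: nonunits_def)
  have "a divides x" using a by (simp add: vertices_def)
  then obtain e where e: "e \<in> carrier R" "x = a \<otimes> e" by (rule dividesE)
  have "e \<notin> Units R"
  proof
    assume "e \<in> Units R"
    then have "PIdl (e \<otimes> a) = PIdl a" using ac by (rule cgenideal_unit_mult)
    with ne e ac show False by (simp add: m_comm)
  qed
  then have "e \<in> graph_elements R any_nonunit" using e by (simp add: graph_elements_def nonunits_def)
  with \<beta> S obtain b where b: "b \<in> S" "b \<in> graph_elements R any_nonunit" "PIdl e = PIdl b"
    by (rule representative_of_ideal)
  have bn: "b \<in> nonunits R" using b(2) by (simp add: graph_elements_def)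
  then have bc: "b \<in> carrier R" by (simp add: nonunits_def)
  obtain r where r: "r \<in> carrier R" "e = r \<otimes> b" using b(3) e(1) by (rule cgenideal_eqE)
  have x_eq: "x = a \<otimes> (b \<otimes> r)" using e(2) r bc by (simp add: m_comm)
  have fact: "\<exists>u\<in>Units R. \<exists>as. factorization R any_nonunit (u \<otimes> x) (a # b # as)"
  proof (cases "r \<in> Units R")
    case True
    have "inv r \<otimes> x = (inv r \<otimes> r) \<otimes> (a \<otimes> b)"
      unfolding x_eq using True ac bc r(1) Units_inv_closed[OF True] by (simp only: m_ac m_closed)
    then have "factorization R any_nonunit (inv r \<otimes> x) [a, b]"
      using True an bn ac bc by (simp add: factorization_def)
    then show ?thesis using Units_inv_Units[OF True] by blast
  next
    case False
    then have "factorization R any_nonunit (\<one> \<otimes> x) [a, b, r]"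
      using an bn r(1) bc x by (simp add: factorization_def nonunits_def x_eq)
    then show ?thesis using Units_one_closed by blast
  qed
  show ?thesis
  proof (cases "a = b")
    case False
    have "x = b \<otimes> (a \<otimes> r)" unfolding x_eq using ac bc r(1) by (rule m_lcomm)
    then have "b divides x" by (rule dividesI[rotated]) (use ac r(1) in simp)
    then have "b \<in> vertices R S x" using b(1) by (simp add: vertices_def)
    moreover have "adjacent R any_nonunit x a b" using fact False by (simp add: adjacent_def)
    ultimately show ?thesis by blast
  next
    case True
    define L where "L = {n. n \<ge> 1 \<and>
      (\<exists>u\<in>Units R. \<exists>as. factorization R any_nonunit (u \<otimes> x) (replicate n a @ as))}"
    have "2 \<in> L" unfolding L_def using fact True by (simp add: numeral_2_eq_2)
    then have "enat (2 - 1) \<le> (SUP n\<in>L. enat (n - 1))" by (rule SUP_upper)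
    then have "(SUP n\<in>L. enat (n - 1)) \<noteq> 0" by (auto simp: zero_enat_def)
    then show ?thesis unfolding num_loops_def L_def[symmetric] by simp
  qed
qed

text \<open>A power \<open>a\<^sup>n\<close> dividing \<open>x\<close> gives a factorization of \<open>x\<close> with at least \<open>n\<close> factors, so the length bound of
\<open>x\<close> bounds both the powers dividing \<open>x\<close> and the multiplicities in factorizations of \<open>u x\<close>.\<close>

lemma (in cring) num_loops_bounded:
  assumes "BFR R" and x: "x \<in> nonunits R - {\<zero>}"
  obtains N where "\<And>a. a \<in> nonunits R \<Longrightarrow> num_loops R any_nonunit x a \<le> enat N"
proof -
  have xc: "x \<in> carrier R" using x by (simp add: nonunits_def)
  obtain N where N: "\<And>as. factorization R any_nonunit x as \<Longrightarrow> length as \<le> N"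
    using assms unfolding BFR_def by blast
  have "num_loops R any_nonunit x a \<le> enat N" if a: "a \<in> nonunits R" for a
  proof -
    have ac: "a \<in> carrier R" using a by (simp add: nonunits_def)
    have "\<not> a [^] n divides x" if n: "n \<ge> Suc N" for n
    proof
      assume "a [^] n divides x"
      then obtain c where c: "c \<in> carrier R" "x = a [^] n \<otimes> c" by (rule dividesE)
      have "factorization R any_nonunit (a [^] n) (replicate n a)"
        using foldr_replicate_append[OF ac, of "[]" n] a n ac by (simp add: factorization_def)
      then obtain bs where "factorization R any_nonunit (c \<otimes> a [^] n) bs" "length bs = length (replicate n a)"
        using c(1) by (rule factorization_mult)
      moreover have "c \<otimes> a [^] n = x" using c ac by (simp add: m_comm)
      ultimately have "n \<le> N" using N by (metis length_replicate)
      with n show False by simp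
    qed
    then have "\<not> (\<forall>N::nat. \<exists>n\<ge>N. a [^] n divides x)" by blast
    moreover have "enat (n - 1) \<le> enat N"
      if u: "u \<in> Units R" and as: "factorization R any_nonunit (u \<otimes> x) (replicate n a @ as)" for n u as
    proof -
      have "inv u \<otimes> (u \<otimes> x) = x" using u xc by (simp add: m_assoc[symmetric] Units_closed)
      then obtain bs where "factorization R any_nonunit x bs" "length bs = length (replicate n a @ as)"
        using factorization_mult[OF as Units_inv_closed[OF u]] by metis
      with N[of bs] show ?thesis by simp
    qed
    ultimately show ?thesis unfolding num_loops_def by (auto intro!: SUP_least)
  qed
  with that show thesis by blast
qed

lemma (in cring) finite_edges_if_BFR:
  assumes "BFR R" and x: "x \<in> nonunits R - {\<zero>}" and S: "S \<subseteq> nonunits R"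
    and fin: "finite (vertices R S x)"
  shows "finite (edges R any_nonunit S x)"
proof -
  obtain N where N: "\<And>a. a \<in> nonunits R \<Longrightarrow> num_loops R any_nonunit x a \<le> enat N"
    using assms(1) x by (rule num_loops_bounded) blast
  let ?V = "vertices R S x"
  have "edges R any_nonunit S x \<subseteq>
      (\<lambda>(a, b). Link {a, b}) ` (?V \<times> ?V) \<union> (\<lambda>(a, i). Loop a i) ` (?V \<times> {..<N})"
  proof
    fix e assume "e \<in> edges R any_nonunit S x"
    then consider a b where "e = Link {a, b}" "a \<in> ?V" "b \<in> ?V"
      | a i where "e = Loop a i" "a \<in> ?V" "enat i < num_loops R any_nonunit x a"
      unfolding edges_def by blast
    then show "e \<in> (\<lambda>(a, b). Link {a, b}) ` (?V \<times> ?V) \<union> (\<lambda>(a, i). Loop a i) ` (?V \<times> {..<N})"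
    proof cases
      case 2
      then have "a \<in> nonunits R" using S by (auto simp: vertices_def)
      with 2(3) have "enat i < enat N" using N less_le_trans by blast
      with 2 show ?thesis by force
    qed force
  qed
  then show ?thesis by (rule finite_subset) (use fin in simp)
qed

text \<open>If \<open>x\<close> has finitely many edges, each with at most two ends, then only finitely many vertices are
incident with an edge, and the remaining ones all generate the ideal \<open>(x)\<close>.\<close>

lemma (in cring) finite_edges_iff:
  assumes \<beta>: "associate_relation R \<beta>"
    and S: "is_representatives \<beta> (graph_elements R any_nonunit) S"
    and BFR: "presimplifiable R \<Longrightarrow> BFR R"
  shows "(\<forall>x\<in>nonunits R - {\<zero>}. finite (edges R any_nonunit S x)) \<longleftrightarrow>
    presimplifiable R \<and> (\<forall>x\<in>nonunits R - {\<zero>}. finite (divisor_ideals R any_nonunit x))"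
    (is "?E \<longleftrightarrow> ?P \<and> ?D")
proof (intro iffI conjI)
  assume E: ?E
  show ?P
    unfolding presimplifiable_def
  proof (intro ballI impI, rule ccontr)
    fix x y assume x: "x \<in> carrier R" and y: "y \<in> carrier R" and xy: "x = x \<otimes> y"
      and neg: "\<not> (x = \<zero> \<or> y \<in> Units R)"
    then have y': "y \<in> nonunits R" by (simp add: nonunits_def)
    then have "x \<in> nonunits R" using nonunits_mult_r(1)[OF y' x] xy by simp
    with E neg have fin: "finite (edges R any_nonunit S x)" by simp
    obtain a where "a \<in> vertices R S x" "num_loops R any_nonunit x a = \<infinity>"
      using \<beta> S x y' xy by (rule absorbed_nonunit_gives_infinite_loops)
    then have "range (Loop a) \<subseteq> edges R any_nonunit S x" by (auto simp: edges_def)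
    then have "finite (range (Loop a))" using fin by (rule finite_subset)
    moreover have "inj (Loop a)" by (rule injI) simp
    ultimately show False using finite_imageD by fastforce
  qed
  show ?D
  proof
    fix x assume x: "x \<in> nonunits R - {\<zero>}"
    then have xc: "x \<in> carrier R" by (simp add: nonunits_def)
    define ends :: "'a edge \<Rightarrow> 'a set" where "ends e = (case e of Link A \<Rightarrow> A | Loop a i \<Rightarrow> {a})" for e
    let ?E = "edges R any_nonunit S x"
    have "finite ?E" using E x by blast
    moreover have "finite (ends e)" if "e \<in> ?E" for e
      using that by (auto simp: edges_def ends_def)
    ultimately have fin: "finite (\<Union>e\<in>?E. ends e)" by blast
    have "a \<in> (\<Union>e\<in>?E. ends e)" if a: "a \<in> vertices R S x" and ne: "PIdl a \<noteq> PIdl x" for a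
      using vertex_has_incident_edge[OF \<beta> S xc a ne]
    proof
      assume "\<exists>b\<in>vertices R S x. adjacent R any_nonunit x a b"
      then obtain b where "b \<in> vertices R S x" "adjacent R any_nonunit x a b" by blast
      then have "Link {a, b} \<in> ?E" using a by (auto simp: edges_def)
      moreover have "a \<in> ends (Link {a, b})" by (simp add: ends_def)
      ultimately show ?thesis by blast
    next
      assume "num_loops R any_nonunit x a \<noteq> 0"
      then have "Loop a 0 \<in> ?E" using a by (auto simp: edges_def zero_enat_def[symmetric])
      moreover have "a \<in> ends (Loop a 0)" by (simp add: ends_def)
      ultimately show ?thesis by blast
    qed
    then have "(\<lambda>a. PIdl a) ` vertices R S x \<subseteq> insert (PIdl x) ((\<lambda>a. PIdl a) ` (\<Union>e\<in>?E. ends e))"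
      by blast
    then have "finite ((\<lambda>a. PIdl a) ` vertices R S x)" by (rule finite_subset) (use fin in simp)
    then show "finite (divisor_ideals R any_nonunit x)" by (simp only: vertex_ideals[OF \<beta> S xc])
  qed
next
  assume PD: "?P \<and> ?D"
  then have "finite_vertices R S"
    using finite_vertices_iff_finite_divisor_ideals[OF \<beta> _ S] by blast
  moreover have "S \<subseteq> nonunits R" using S by (auto simp: is_representatives_def graph_elements_def)
  ultimately show ?E
    using finite_edges_if_BFR BFR PD unfolding finite_vertices_def by blast
qed

text \<open>Partial sums over finite sets are lower bounds for the infinite sum, and nonzero terms are at least
\<open>1\<close>.\<close>

lemma finite_support_if_infsum_enat_finite:
  fixes f :: "'c \<Rightarrow> enat"
  assumes "infsum f A < \<infinity>"
  shows "finite {a \<in> A. f a \<noteq> 0}" and "\<And>a. a \<in> A \<Longrightarrow> f a \<noteq> \<infinity>"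
proof -
  have le: "sum f F \<le> infsum f A" if "finite F" "F \<subseteq> A" for F
    by (subst nonneg_infsum_complete) (use that in \<open>auto intro: SUP_upper\<close>)
  obtain k where k: "infsum f A = enat k" using assms by (cases "infsum f A") auto
  show "finite {a \<in> A. f a \<noteq> 0}"
  proof (rule ccontr)
    assume "infinite {a \<in> A. f a \<noteq> 0}"
    then obtain F where F: "F \<subseteq> {a \<in> A. f a \<noteq> 0}" "finite F" "card F = Suc k"
      using infinite_arbitrarily_large by blast
    have "of_nat (card F) * 1 \<le> sum f F"
      using F(1) by (intro sum_bounded_below) (auto simp: one_eSuc ileI1 gr_zeroI)
    also have "\<dots> \<le> enat k" using le[OF F(2)] F(1) k by auto
    finally show False by (simp add: F(3) of_nat_eq_enat)
  qed
  show "f a \<noteq> \<infinity>" if "a \<in> A" for a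
    using le[of "{a}"] that k by (cases "f a") auto
qed

lemma sum_enat_finite:
  fixes f :: "'c \<Rightarrow> enat"
  assumes "\<And>a. a \<in> A \<Longrightarrow> f a \<noteq> \<infinity>"
  shows "sum f A < \<infinity>"
  using assms by (induction A rule: infinite_finite_induct)
    (auto simp: plus_eq_infty_iff_enat simp del: not_infinity_eq)

text \<open>The argument for edges carries over because a vertex with an incident edge or loop has a nonzero
degree, and a vertex with infinitely many loops an infinite one.\<close>

lemma (in cring) finite_degree_sum_iff:
  assumes \<beta>: "associate_relation R \<beta>"
    and S: "is_representatives \<beta> (graph_elements R any_nonunit) S"
    and BFR: "presimplifiable R \<Longrightarrow> BFR R"
  shows "(\<forall>x\<in>nonunits R - {\<zero>}. (\<Sum>\<^sub>\<infinity>a\<in>vertices R S x. degl R any_nonunit S x a) < \<infinity>) \<longleftrightarrow>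
    presimplifiable R \<and> (\<forall>x\<in>nonunits R - {\<zero>}. finite (divisor_ideals R any_nonunit x))"
    (is "?E \<longleftrightarrow> ?P \<and> ?D")
proof (intro iffI conjI)
  assume E: ?E
  show ?P
    unfolding presimplifiable_def
  proof (intro ballI impI, rule ccontr)
    fix x y assume x: "x \<in> carrier R" and y: "y \<in> carrier R" and xy: "x = x \<otimes> y"
      and neg: "\<not> (x = \<zero> \<or> y \<in> Units R)"
    then have y': "y \<in> nonunits R" by (simp add: nonunits_def)
    then have "x \<in> nonunits R" using nonunits_mult_r(1)[OF y' x] xy by simp
    with E neg have fin: "(\<Sum>\<^sub>\<infinity>a\<in>vertices R S x. degl R any_nonunit S x a) < \<infinity>" by simp
    obtain a where a: "a \<in> vertices R S x" "num_loops R any_nonunit x a = \<infinity>"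
      using \<beta> S x y' xy by (rule absorbed_nonunit_gives_infinite_loops)
    have "degl R any_nonunit S x a = \<infinity>" using a(2) by (simp add: degl_def)
    with finite_support_if_infsum_enat_finite(2)[OF fin a(1)] show False by contradiction
  qed
  show ?D
  proof
    fix x assume x: "x \<in> nonunits R - {\<zero>}"
    then have xc: "x \<in> carrier R" by (simp add: nonunits_def)
    let ?V' = "{a \<in> vertices R S x. degl R any_nonunit S x a \<noteq> 0}"
    have fin: "finite ?V'" by (rule finite_support_if_infsum_enat_finite) (use E x in blast)
    have "degl R any_nonunit S x a \<noteq> 0" if a: "a \<in> vertices R S x" and ne: "PIdl a \<noteq> PIdl x" for a
      using vertex_has_incident_edge[OF \<beta> S xc a ne]
    proof
      assume "\<exists>b\<in>vertices R S x. adjacent R any_nonunit x a b"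
      then have "{b \<in> vertices R S x. adjacent R any_nonunit x a b} \<noteq> {}" by blast
      then have "deg R any_nonunit S x a \<noteq> 0" by (simp add: deg_def Let_def zero_enat_def)
      then show ?thesis by (simp add: degl_def)
    qed (simp add: degl_def)
    then have "(\<lambda>a. PIdl a) ` vertices R S x \<subseteq> insert (PIdl x) ((\<lambda>a. PIdl a) ` ?V')" by blast
    then have "finite ((\<lambda>a. PIdl a) ` vertices R S x)" by (rule finite_subset) (use fin in simp)
    then show "finite (divisor_ideals R any_nonunit x)" by (simp only: vertex_ideals[OF \<beta> S xc])
  qed
next
  assume PD: "?P \<and> ?D"
  then have fv: "finite_vertices R S"
    using finite_vertices_iff_finite_divisor_ideals[OF \<beta> _ S] by blast
  have SN: "S \<subseteq> nonunits R" using S by (auto simp: is_representatives_def graph_elements_def)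
  show ?E
  proof
    fix x assume x: "x \<in> nonunits R - {\<zero>}"
    have V: "finite (vertices R S x)" using fv x unfolding finite_vertices_def by blast
    obtain N where N: "\<And>a. a \<in> nonunits R \<Longrightarrow> num_loops R any_nonunit x a \<le> enat N"
      using BFR x PD by (blast intro: num_loops_bounded)
    have "degl R any_nonunit S x a \<noteq> \<infinity>" if a: "a \<in> vertices R S x" for a
    proof -
      have "a \<in> nonunits R" using a SN by (auto simp: vertices_def)
      then have "num_loops R any_nonunit x a \<noteq> \<infinity>" using N[of a]
        by (cases "num_loops R any_nonunit x a") auto
      then show ?thesis using V by (auto simp: degl_def deg_def Let_def)
    qed
    then show "(\<Sum>\<^sub>\<infinity>a\<in>vertices R S x. degl R any_nonunit S x a) < \<infinity>"
      unfolding infsum_finite[OF V] by (rule sum_enat_finite)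
  qed
qed

theorem corollary5p13:
  fixes R :: "('a, 'b) ring_scheme"
    and \<alpha> :: "'a \<Rightarrow> bool"
    and \<beta> :: "'a \<Rightarrow> 'a \<Rightarrow> bool"
    and A\<^sub>0 A\<^sub>\<alpha> :: "'a set"
  assumes "cring R" and "noetherian_ring R" and "\<one>\<^bsub>R\<^esub> \<noteq> \<zero>\<^bsub>R\<^esub>"
    and "\<alpha> \<in> {atomic R, strongly_atomic R, m_atomic R, very_strongly_atomic R}"
    and "\<beta> \<in> {associates R, strong_associates R, very_strong_associates R}"
    and "is_representatives \<beta> (graph_elements R any_nonunit) A\<^sub>0"
    and "is_representatives \<beta> (graph_elements R \<alpha>) A\<^sub>\<alpha>"
  shows
    "(FFR R \<beta> \<longleftrightarrow> BFR R \<and> WFFR R \<beta>) \<and>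
     (FFR R \<beta> \<longleftrightarrow> presimplifiable R \<and> WFFR R \<beta>) \<and>
     (FFR R \<beta> \<longleftrightarrow> principal_powers_meet_zero R \<and> WFFR R \<beta>) \<and>
     (FFR R \<beta> \<longleftrightarrow> ideal_powers_meet_zero R \<and> WFFR R \<beta>) \<and>
     (FFR R \<beta> \<longleftrightarrow> BFR R \<and> divisor_finite R \<alpha> \<beta>) \<and>
     (FFR R \<beta> \<longleftrightarrow> presimplifiable R \<and> divisor_finite R \<alpha> \<beta>) \<and>
     (FFR R \<beta> \<longleftrightarrow> principal_powers_meet_zero R \<and> divisor_finite R \<alpha> \<beta>) \<and>
     (FFR R \<beta> \<longleftrightarrow> ideal_powers_meet_zero R \<and> divisor_finite R \<alpha> \<beta>) \<and>
     (FFR R \<beta> \<longleftrightarrow> (\<forall>x\<in>nonunits R - {\<zero>\<^bsub>R\<^esub>}.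
                    (\<Sum>\<^sub>\<infinity>a\<in>vertices R A\<^sub>0 x. degl R any_nonunit A\<^sub>0 x a) < \<infinity>)) \<and>
     (FFR R \<beta> \<longleftrightarrow> (\<forall>x\<in>nonunits R - {\<zero>\<^bsub>R\<^esub>}. finite (edges R any_nonunit A\<^sub>0 x))) \<and>
     (FFR R \<beta> \<longleftrightarrow> BFR R \<and> finite_vertices R A\<^sub>0) \<and>
     (FFR R \<beta> \<longleftrightarrow> presimplifiable R \<and> finite_vertices R A\<^sub>0) \<and>
     (FFR R \<beta> \<longleftrightarrow> principal_powers_meet_zero R \<and> finite_vertices R A\<^sub>0) \<and>
     (FFR R \<beta> \<longleftrightarrow> ideal_powers_meet_zero R \<and> finite_vertices R A\<^sub>0) \<and>
     (FFR R \<beta> \<longleftrightarrow> BFR R \<and> finite_vertices R A\<^sub>\<alpha>) \<and>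
     (FFR R \<beta> \<longleftrightarrow> presimplifiable R \<and> finite_vertices R A\<^sub>\<alpha>) \<and>
     (FFR R \<beta> \<longleftrightarrow> principal_powers_meet_zero R \<and> finite_vertices R A\<^sub>\<alpha>) \<and>
     (FFR R \<beta> \<longleftrightarrow> ideal_powers_meet_zero R \<and> finite_vertices R A\<^sub>\<alpha>)"
proof -
  interpret noetherian_cring R
    using assms(1,2) by (rule noetherian_cring.intro[rotated])
  let ?N = "nonunits R - {\<zero>\<^bsub>R\<^esub>}"
  \<comment> \<open>Every condition reduces to presimplifiability together with finitely many divisor ideals, counted
    with respect to all nonunits or to \<open>\<alpha>\<close>.\<close>
  define D where "D \<gamma> \<longleftrightarrow> (\<forall>x\<in>?N. finite (divisor_ideals R \<gamma> x))" for \<gamma>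
  have \<beta>: "associate_relation R \<beta>" using assms(5) by (rule associate_relations)
  have \<alpha>: "a \<in> nonunits R" if "\<alpha> a" for a
    using assms(4) that
    by (auto simp: atomic_def strongly_atomic_def m_atomic_def very_strongly_atomic_def)
  have BFR: "BFR R \<longleftrightarrow> presimplifiable R"
    using BFR_imp_presimplifiable presimplifiable_imp_BFR by blast
  have ideals: "ideal_powers_meet_zero R \<longleftrightarrow> presimplifiable R"
    and principal: "principal_powers_meet_zero R \<longleftrightarrow> presimplifiable R"
    using presimplifiable_imp_ideal_powers_meet_zero ideal_powers_meet_zero_imp_principal
      principal_powers_meet_zero_imp_presimplifiable by blast+
  have FFR: "FFR R \<beta> \<longleftrightarrow> presimplifiable R \<and> D any_nonunit"
    using FFR_iff_finite_divisor_ideals[OF \<beta>] BFR by (simp add: D_def)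
  have edges: "(\<forall>x\<in>?N. finite (edges R any_nonunit A\<^sub>0 x)) \<longleftrightarrow> presimplifiable R \<and> D any_nonunit"
    unfolding D_def by (rule finite_edges_iff[OF \<beta> assms(6)]) (simp add: BFR)
  have degrees: "(\<forall>x\<in>?N. (\<Sum>\<^sub>\<infinity>a\<in>vertices R A\<^sub>0 x. degl R any_nonunit A\<^sub>0 x a) < \<infinity>) \<longleftrightarrow>
      presimplifiable R \<and> D any_nonunit"
    unfolding D_def by (rule finite_degree_sum_iff[OF \<beta> assms(6)]) (simp add: BFR)
  show ?thesis
  proof (cases "presimplifiable R")
    case True
    have "D \<alpha> \<longleftrightarrow> D any_nonunit"
      unfolding D_def
      using finite_divisor_ideals_iff_atoms[OF _ irreducible_notions_contain_atoms[OF True assms(4)]]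
        BFR True by simp
    moreover have "WFFR R \<beta> \<longleftrightarrow> D any_nonunit"
      unfolding D_def by (rule WFFR_iff_finite_divisor_ideals[OF \<beta> True])
    moreover have "divisor_finite R \<alpha> \<beta> \<longleftrightarrow> D \<alpha>"
      unfolding D_def by (rule divisor_finite_iff_finite_divisor_ideals[OF \<beta> True \<alpha>])
    moreover have "finite_vertices R A\<^sub>0 \<longleftrightarrow> D any_nonunit"
      unfolding D_def by (rule finite_vertices_iff_finite_divisor_ideals[OF \<beta> True assms(6)])
    moreover have "finite_vertices R A\<^sub>\<alpha> \<longleftrightarrow> D \<alpha>"
      unfolding D_def by (rule finite_vertices_iff_finite_divisor_ideals[OF \<beta> True assms(7)])
    ultimately show ?thesis
      by (simp only: FFR BFR ideals principal edges degrees True simp_thms)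
  next
    case False
    then show ?thesis by (simp only: FFR BFR ideals principal edges degrees simp_thms)
  qed
qed

end
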